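(* For all integers $n\geq 2$ and $r\geq 1$, the Higman-Thompson group $G_{n,r}$ is co-context-free (co$CF$); that is, its co-word problem is a context-free language.
   Context: Co-word problem: let $G$ be a group with a finite generating set $X$. The word problem $W(G,X)$ is the set of all words in $(X^{\pm})^*$ (words in the generators and their inverses) that represent the identity of $G$. The co-word problem $\mathrm{coW}(G,X)$ is its complement, the set of words in $(X^{\pm})^*$ that do not represent $1$ in $G$. A finitely generated group $G$ is called co$CF$ if $\mathrm{coW}(G,X)$ is a context-free language. This is known to be independent of the choice of finite generating set $X$. Higman-Thompson groups: fix integers $n\geq 2$, $r\geq 1$ and let $Q=\{q_1,\ldots,q_r\}$ and $\Sigma=\{\sigma_1,\ldots,\sigma_n\}$ be two finite sets (disjoint alphabets with $r$ and $n$ elements respectively). Let $\Omega=Q\Sigma^{\mathbb{N}}$ be the set of infinite sequences consisting of an element of $Q$ followed by an infinite sequence of elements of $\Sigma$. A barrier is a subset $B\subset Q\Sigma^*$ such that for every $\omega\in\Omega$ there is exactly one $b\in B$ with $\omega\in b\Sigma^{\mathbb{N}}$, i.e. $b$ is the unique prefix of $\omega$ in $B$. Two barriers $B_1,B_2$ of the same cardinality and a bijection $\phi:B_1\to B_2$ induce a bijection $g_\phi:\Omega\to\Omega$ by prefix replacement: $g_\phi(b\omega')=\phi(b)\omega'$ for $b\in B_1$, $\omega'\in\Sigma^{\mathbb{N}}$. The set of all such induced bijections forms a group under composition, the Higman-Thompson group $G_{n,r}$. It is known (Higman) that $G_{n,r}$ is finitely presented, in particular finitely generated. *)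

theory Defs
  imports "HOL-Algebra.Bij" "HOL-Algebra.Generated_Groups" "HOL-Library.Stream"
begin

datatype ('n, 't) symbol = Nt 'n | Tm 't

type_synonym ('n, 't) productions = "('n \<times> ('n, 't) symbol list) set"

inductive derive_step :: "('n, 't) productions \<Rightarrow> ('n, 't) symbol list \<Rightarrow> ('n, 't) symbol list \<Rightarrow> bool"
  for P where
  "(A, \<alpha>) \<in> P \<Longrightarrow> derive_step P (u @ [Nt A] @ v) (u @ \<alpha> @ v)"

definition cfg_language :: "('n, 't) productions \<Rightarrow> 'n \<Rightarrow> 't list set" where
  "cfg_language P S = {w. (derive_step P)\<^sup>*\<^sup>* [Nt S] (map Tm w)}"

text \<open>
  A grammar is a finite set of productions with a start symbol. Only finitely many nonterminals
  and terminals occur in it, so taking the nonterminals from \<^typ>\<open>nat\<close> is no restriction.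
\<close>

definition context_free :: "'t list set \<Rightarrow> bool" where
  "context_free L \<longleftrightarrow>
     (\<exists>(P :: (nat, 't) productions) S. finite P \<and> L = cfg_language P S)"

text \<open>
  The alphabet of formal generators and formal inverses is \<open>X \<times> UNIV\<close>: the letter
  \<open>(x, True)\<close> stands for \<open>x\<close> and \<open>(x, False)\<close> for its inverse.
\<close>

definition letter_value :: "('a, 'b) monoid_scheme \<Rightarrow> 'a \<times> bool \<Rightarrow> 'a" where
  "letter_value G l = (if snd l then fst l else inv\<^bsub>G\<^esub> (fst l))"

definition word_value :: "('a, 'b) monoid_scheme \<Rightarrow> ('a \<times> bool) list \<Rightarrow> 'a" where
  "word_value G w = foldr (\<lambda>l g. letter_value G l \<otimes>\<^bsub>G\<^esub> g) w \<one>\<^bsub>G\<^esub>"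

definition word_problem :: "('a, 'b) monoid_scheme \<Rightarrow> 'a set \<Rightarrow> ('a \<times> bool) list set" where
  "word_problem G X = {w \<in> lists (X \<times> UNIV). word_value G w = \<one>\<^bsub>G\<^esub>}"

definition coword_problem :: "('a, 'b) monoid_scheme \<Rightarrow> 'a set \<Rightarrow> ('a \<times> bool) list set" where
  "coword_problem G X = lists (X \<times> UNIV) - word_problem G X"

definition finite_generating_set :: "('a, 'b) monoid_scheme \<Rightarrow> 'a set \<Rightarrow> bool" where
  "finite_generating_set G X \<longleftrightarrow> finite X \<and> X \<subseteq> carrier G \<and> generate G X = carrier G"

text \<open>
  Whether the co-word problem is context-free does not depend on the finite generating set. The
  definition asks for it for all of them, and separately for the existence of one.
\<close>

definition co_context_free :: "('a, 'b) monoid_scheme \<Rightarrow> bool" where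
  "co_context_free G \<longleftrightarrow>
     group G \<and> (\<exists>X. finite_generating_set G X) \<and>
     (\<forall>X. finite_generating_set G X \<longrightarrow> context_free (coword_problem G X))"

text \<open>
  The alphabets are \<open>Q = {..<r}\<close> and \<open>\<Sigma> = {..<n}\<close>. They are kept apart by pairing: a finite
  word \<open>q u\<close> with \<open>u \<in> \<Sigma>\<^sup>*\<close> is the pair \<open>(q, u)\<close>, and likewise for infinite words.
\<close>

definition ht_words :: "nat \<Rightarrow> nat \<Rightarrow> (nat \<times> nat list) set" where
  "ht_words n r = {..<r} \<times> lists {..<n}"

definition ht_Omega :: "nat \<Rightarrow> nat \<Rightarrow> (nat \<times> nat stream) set" where
  "ht_Omega n r = {..<r} \<times> streams {..<n}"

definition extend :: "nat \<times> nat list \<Rightarrow> nat stream \<Rightarrow> nat \<times> nat stream" where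
  "extend b \<omega> = (fst b, snd b @- \<omega>)"

definition barrier :: "nat \<Rightarrow> nat \<Rightarrow> (nat \<times> nat list) set \<Rightarrow> bool" where
  "barrier n r B \<longleftrightarrow>
     B \<subseteq> ht_words n r \<and>
     (\<forall>\<omega> \<in> ht_Omega n r. \<exists>!b. b \<in> B \<and> \<omega> \<in> extend b ` streams {..<n})"

text \<open>
  As \<open>B\<^sub>1\<close> is a barrier, the equation determines \<open>g\<close> on all of \<^const>\<open>ht_Omega\<close>; outside of it
  the members of \<^const>\<open>Bij\<close> are \<^const>\<open>undefined\<close>.
\<close>

definition induced_by ::
    "nat \<Rightarrow> nat \<Rightarrow> (nat \<times> nat list) set \<Rightarrow> (nat \<times> nat list \<Rightarrow> nat \<times> nat list) \<Rightarrow>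
     (nat \<times> nat stream \<Rightarrow> nat \<times> nat stream) \<Rightarrow> bool" where
  "induced_by n r B\<^sub>1 \<phi> g \<longleftrightarrow>
     g \<in> Bij (ht_Omega n r) \<and>
     (\<forall>b \<in> B\<^sub>1. \<forall>\<omega> \<in> streams {..<n}. g (extend b \<omega>) = extend (\<phi> b) \<omega>)"

definition higman_thompson :: "nat \<Rightarrow> nat \<Rightarrow> (nat \<times> nat stream \<Rightarrow> nat \<times> nat stream) monoid" where
  "higman_thompson n r = BijGroup (ht_Omega n r)
     \<lparr>carrier := {g. \<exists>B\<^sub>1 B\<^sub>2 \<phi>. barrier n r B\<^sub>1 \<and> barrier n r B\<^sub>2 \<and> bij_betw \<phi> B\<^sub>1 B\<^sub>2 \<and>
                              induced_by n r B\<^sub>1 \<phi> g}\<rparr>"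

end

theory Submission
  imports Defs "HOL-Library.Countable"
begin

text \<open>
  An element of \<open>G\<^bsub>n,r\<^esub>\<close> replaces prefixes: by Koenig's lemma a barrier is finite, and so every element
  acts on the cone of each sufficiently long word \<open>b\<close> by replacing \<open>b\<close> with another word (\<open>carrier_iff\<close>).
  This yields the group laws and two more substantial facts.

  The co-word problem. Fix a finite set of letters and a level at which all of them replace
  prefixes. They become the rules of a finite labelled prefix-rewriting system, that is, of a
  pushdown automaton, and a word of letters is nontrivial iff it labels a run from some word \<open>b\<close> to some
  word \<open>c \<noteq> b\<close>. For every such system the labels of the runs with \<open>b \<noteq> c\<close> form a context-free
  language (\<open>context_free_nontrivial_runs\<close>). An automaton that starts with a guessed stack \<open>b\<close> no longer
  knows \<open>b\<close> at the end, but a grammar can compare \<open>b\<close> and \<open>c\<close>. Write \<open>b = b' \<cdot> s\<close> and \<open>c = c' \<cdot> s\<close>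
  with \<open>s\<close> as long as possible. A run consumes \<open>s\<close> from the top to the bottom and afterwards builds
  it up again from the bottom to the top, so the part of the label that consumes a letter of \<open>s\<close>
  and the part that restores it enclose the parts for all deeper letters. The nesting is
  generated from the outside in, with one letter of \<open>s\<close> guessed at each stage. Outside of it
  the only condition is that \<open>b'\<close> and \<open>c'\<close> differ at their ends, which finitely many cases describe.
  The bounded words at which a run is cut come from the first and the last touch of a suffix
  (\<open>run_first_touch\<close>, \<open>run_last_touch\<close>).

  Finite generation. The involutions \<open>swap u v\<close> that exchange the cones of two incomparable words generate
  the group: swaps move a set of sibling cones from a place that is too deep to one that is not deep enough,
  until the element permutes the words of one length, and permutations are products of
  transpositions (\<open>replacement_map_in_generated\<close>). A swap of long words is conjugate to a swap of shorter
  words by a swap of words of length at most 3 (\<open>swap_in_generated\<close>), so the finitely many swaps of words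
  of length at most 3 suffice.
\<close>

section \<open>Context-free grammars\<close>

lemma derive_step_context:
  assumes "derive_step P \<alpha> \<beta>"
  shows "derive_step P (u @ \<alpha> @ v) (u @ \<beta> @ v)"
  using assms
proof cases
  case (1 A \<gamma> u' v')
  then show ?thesis
    using derive_step.intros[of A \<gamma> P "u @ u'" "v' @ v"] by simp
qed

lemma derives_context:
  assumes "(derive_step P)\<^sup>*\<^sup>* \<alpha> \<beta>"
  shows "(derive_step P)\<^sup>*\<^sup>* (u @ \<alpha> @ v) (u @ \<beta> @ v)"
  using assms
  by induction (auto intro: rtranclp.rtrancl_into_rtrancl derive_step_context)

lemma derives_append:
  assumes "(derive_step P)\<^sup>*\<^sup>* \<alpha> \<alpha>'" and "(derive_step P)\<^sup>*\<^sup>* \<beta> \<beta>'"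
  shows "(derive_step P)\<^sup>*\<^sup>* (\<alpha> @ \<beta>) (\<alpha>' @ \<beta>')"
  using derives_context[OF assms(1), of "[]" \<beta>] derives_context[OF assms(2), of \<alpha>' "[]"]
  by simp

text \<open>
  Variables of a grammar are interpreted as arbitrary languages, and sentential forms as the
  corresponding concatenations. Both directions of a correctness proof for a grammar then speak about
  single productions: \<open>cfg_language_subset\<close> says that an interpretation that is closed under the
  productions bounds the generated languages from above, and \<open>yieldsI\<close> that the generated languages
  are themselves such an interpretation.
\<close>

fun form_language :: "('n \<Rightarrow> 't list set) \<Rightarrow> ('n, 't) symbol list \<Rightarrow> 't list set" where
  "form_language L [] = {[]}"
| "form_language L (Tm t # \<alpha>) = (#) t ` form_language L \<alpha>"
| "form_language L (Nt A # \<alpha>) = {u @ v | u v. u \<in> L A \<and> v \<in> form_language L \<alpha>}"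

lemma form_language_append:
  "form_language L (\<alpha> @ \<beta>) = {u @ v | u v. u \<in> form_language L \<alpha> \<and> v \<in> form_language L \<beta>}"
proof (induction L \<alpha> rule: form_language.induct)
  case (2 L t \<alpha>)
  then show ?case by (auto simp: image_iff) (metis append_Cons)+
next
  case (3 L A \<alpha>)
  then show ?case by auto (metis append.assoc)+
qed auto

lemma form_language_terminals: "form_language L (map Tm w) = {w}"
  by (induction w) auto

lemma cfg_language_subset:
  assumes closed: "\<And>A \<alpha>. (A, \<alpha>) \<in> P \<Longrightarrow> form_language L \<alpha> \<subseteq> L A"
  shows "cfg_language P S \<subseteq> L S"
proof
  fix w assume "w \<in> cfg_language P S"
  then have "(derive_step P)\<^sup>*\<^sup>* [Nt S] (map Tm w)"
    by (simp add: cfg_language_def)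
  then have "w \<in> form_language L [Nt S]"
  proof (induction rule: converse_rtranclp_induct)
    case base
    then show ?case by (simp add: form_language_terminals)
  next
    case (step \<alpha> \<beta>)
    from step(1) show ?case
    proof cases
      case (1 A \<gamma> u v)
      then have "form_language L \<gamma> \<subseteq> form_language L [Nt A]"
        using closed by fastforce
      then show ?thesis
        using step.IH 1 unfolding 1 form_language_append by blast
    qed
  qed
  then show "w \<in> L S" by simp
qed

fun rename_symbol :: "('n \<Rightarrow> 'm) \<Rightarrow> ('n, 't) symbol \<Rightarrow> ('m, 't) symbol" where
  "rename_symbol f (Nt A) = Nt (f A)"
| "rename_symbol f (Tm t) = Tm t"

lemma yieldsI:
  assumes "(A, \<alpha>) \<in> P" and "w \<in> form_language (cfg_language P) \<alpha>"
  shows "w \<in> cfg_language P A"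
proof -
  have "(derive_step P)\<^sup>*\<^sup>* \<alpha> (map Tm w)"
    using assms(2)
  proof (induction \<alpha> arbitrary: w)
    case (Cons x \<alpha>)
    show ?case
    proof (cases x)
      case (Nt A)
      then obtain u v where "w = u @ v" "u \<in> cfg_language P A" "v \<in> form_language (cfg_language P) \<alpha>"
        using Cons.prems by auto
      then show ?thesis
        using derives_append[OF _ Cons.IH] Nt by (fastforce simp: cfg_language_def)
    next
      case (Tm t)
      then obtain v where "w = t # v" "v \<in> form_language (cfg_language P) \<alpha>"
        using Cons.prems by auto
      then show ?thesis
        using derives_append[OF rtranclp.rtrancl_refl[of _ "[Tm t]"] Cons.IH] Tm by fastforce
    qed
  qed simp
  moreover have "derive_step P [Nt A] \<alpha>"
    using derive_step.intros[OF assms(1), of "[]" "[]"] by simp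
  ultimately show ?thesis by (simp add: cfg_language_def converse_rtranclp_into_rtranclp)
qed

lemma form_language_rename:
  "form_language L (map (rename_symbol f) \<alpha>) = form_language (L \<circ> f) \<alpha>"
  by (induction "L \<circ> f" \<alpha> rule: form_language.induct) auto

text \<open>
  An injection of the variables into \<^typ>\<open>nat\<close> turns the grammar into one of the kind that
  \<^const>\<open>context_free\<close> asks for. That the new grammar generates nothing else follows by pulling
  the old languages back along a left inverse of the injection.
\<close>

lemma context_free_cfg_language:
  fixes P :: "('n :: countable, 't) productions"
  assumes "finite P"
  shows "context_free (cfg_language P S)"
proof -
  define f :: "'n \<Rightarrow> nat" where "f = to_nat"
  define P' where "P' = (\<lambda>(A, \<alpha>). (f A, map (rename_symbol f) \<alpha>)) ` P"
  have "cfg_language P S \<subseteq> (cfg_language P' \<circ> f) S"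
  proof (rule cfg_language_subset)
    fix A \<alpha> assume "(A, \<alpha>) \<in> P"
    then have "(f A, map (rename_symbol f) \<alpha>) \<in> P'"
      unfolding P'_def by force
    from yieldsI[OF this] show "form_language (cfg_language P' \<circ> f) \<alpha> \<subseteq> (cfg_language P' \<circ> f) A"
      by (auto simp: form_language_rename)
  qed
  moreover
  have inv_f: "(cfg_language P \<circ> from_nat) \<circ> f = cfg_language P"
    by (auto simp: f_def)
  have "cfg_language P' (f S) \<subseteq> (cfg_language P \<circ> from_nat) (f S)"
  proof (rule cfg_language_subset)
    fix B \<beta> assume "(B, \<beta>) \<in> P'"
    then obtain A \<alpha> where "(A, \<alpha>) \<in> P" "B = f A" "\<beta> = map (rename_symbol f) \<alpha>"
      by (auto simp: P'_def)
    then show "form_language (cfg_language P \<circ> from_nat) \<beta> \<subseteq> (cfg_language P \<circ> from_nat) B"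
      using yieldsI[of A \<alpha> P] by (auto simp only: form_language_rename inv_f) (simp add: f_def)
  qed
  ultimately have "cfg_language P S = cfg_language P' (f S)"
    by (simp add: f_def)
  moreover have "finite P'"
    using assms by (simp add: P'_def)
  ultimately show ?thesis
    unfolding context_free_def by blast
qed

section \<open>Prefix rewriting\<close>

text \<open>
  A word is a state \<open>q\<close> followed by a stack \<open>u\<close>, kept as a pair as in \<^const>\<open>ht_words\<close>. Rewriting
  acts on the front of a word, so the far end of the list is the bottom of the stack.
\<close>

definition append_word :: "'q \<times> 'a list \<Rightarrow> 'a list \<Rightarrow> 'q \<times> 'a list" (infixl "\<cdot>" 70) where
  "b \<cdot> s = (fst b, snd b @ s)"

lemma append_word_simps [simp]:
  "fst (b \<cdot> s) = fst b" "snd (b \<cdot> s) = snd b @ s" "b \<cdot> [] = b" "b \<cdot> s \<cdot> t = b \<cdot> (s @ t)"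
  by (simp_all add: append_word_def)

lemma append_word_cancel [simp]: "b \<cdot> s = c \<cdot> s \<longleftrightarrow> b = c"
  by (auto simp: append_word_def prod_eq_iff)

lemma append_word_eq_append_word:
  assumes "b \<cdot> s = c \<cdot> t" and "length (snd b) \<le> length (snd c)"
  obtains u where "c = b \<cdot> u" "s = u @ t"
proof -
  have "snd b @ s = snd c @ t" "fst b = fst c"
    using assms(1) by (simp_all add: append_word_def)
  then have "\<exists>u. snd c = snd b @ u \<and> s = u @ t"
    using assms(2) by (auto simp: append_eq_append_conv2)
  then obtain u where "snd c = snd b @ u" "s = u @ t" by blast
  then show thesis
    using that \<open>fst b = fst c\<close> by (simp add: append_word_def prod_eq_iff)
qed

text \<open>
  Two words with different end marks stay different when a common suffix is appended, and every pair of
  different words arises in this way from such a pair, by removing the longest common suffix. Since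
  there are only finitely many end marks, a grammar can guess them and so certify \<open>b \<noteq> c\<close> although the
  two words are unbounded.
\<close>

definition end_mark :: "'q \<times> 'a list \<Rightarrow> 'q + 'a" where
  "end_mark b = (if snd b = [] then Inl (fst b) else Inr (last (snd b)))"

lemma end_mark_append_word [simp]: "end_mark (b \<cdot> [a]) = Inr a"
  by (simp add: end_mark_def)

lemma append_word_last_cases:
  obtains "snd b = []" | b' a where "b = b' \<cdot> [a]"
  by (metis append_word_def fst_conv prod.collapse rev_exhaust snd_conv)

lemma end_mark_neq_append_word:
  assumes "end_mark b \<noteq> end_mark c"
  shows "b \<cdot> s \<noteq> c \<cdot> s"
  using assms by auto

lemma strip_common_suffix:
  assumes "b \<noteq> c"
  obtains b' c' s where "b = b' \<cdot> s" "c = c' \<cdot> s" "end_mark b' \<noteq> end_mark c'"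
proof -
  have "\<exists>b' c' s. b = b' \<cdot> s \<and> c = c' \<cdot> s \<and> end_mark b' \<noteq> end_mark c'"
    using assms
  proof (induction "length (snd b)" arbitrary: b c rule: less_induct)
    case less
    show ?case
    proof (cases "end_mark b = end_mark c")
      case False
      then show ?thesis by (metis append_word_simps(3))
    next
      case True
      show ?thesis
      proof (cases b rule: append_word_last_cases)
        case 1
        then have "b = c"
          using True by (auto simp: end_mark_def prod_eq_iff split: if_splits)
        then show ?thesis using less.prems by simp
      next
        case (2 b0 a)
        with True have "end_mark c = Inr a" by simp
        then obtain c0 where c0: "c = c0 \<cdot> [a]"
          by (cases c rule: append_word_last_cases) (auto simp: end_mark_def)
        from less.hyps[of b0 c0] obtain b' c' s
          where "b0 = b' \<cdot> s" "c0 = c' \<cdot> s" "end_mark b' \<noteq> end_mark c'"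
          using 2 c0 less.prems by auto
        then show ?thesis
          using 2 c0 by (intro exI[of _ b'] exI[of _ c'] exI[of _ "s @ [a]"]) simp
      qed
    qed
  qed
  then show thesis using that by blast
qed

text \<open>
  The variables of the grammar for nontrivial runs. \<open>Run b c\<close> stands for the labels of runs from \<open>b\<close>
  to \<open>c\<close>, \<open>Run_Above b c\<close> for those of runs from \<open>b \<cdot> s\<close> to \<open>c \<cdot> s\<close> for some \<open>s\<close>, \<open>Run_From k e\<close> for
  those of runs to \<open>e\<close> from some word with end mark \<open>k\<close>, and \<open>Run_To f k\<close> for those of runs from \<open>f\<close>
  to some word with end mark \<open>k\<close>. Only bounded words occur as indices.
\<close>

datatype ('q, 'a) variable =
    Start
  | Run "'q \<times> 'a list" "'q \<times> 'a list"
  | Run_Above "'q \<times> 'a list" "'q \<times> 'a list"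
  | Run_From "'q + 'a" "'q \<times> 'a list"
  | Run_To "'q \<times> 'a list" "'q + 'a"

instance variable :: (countable, countable) countable
  by countable_datatype

text \<open>
  A rule \<open>(l, b, c)\<close> rewrites \<open>b \<cdot> v\<close> to \<open>c \<cdot> v\<close> for every \<open>v\<close> and emits the label \<open>l\<close>. The bound \<open>N\<close>
  on the sides of the rules is also the bound on the words that index the variables.
\<close>

locale prefix_rewriting =
  fixes Qs :: "'q :: countable set"
    and \<Gamma> :: "'a :: countable set"
    and rules :: "('t \<times> ('q \<times> 'a list) \<times> ('q \<times> 'a list)) set"
    and N :: nat
  assumes finite_states: "finite Qs"
    and finite_alphabet: "finite \<Gamma>"
    and finite_rules: "finite rules"
    and rules_words: "(l, b, c) \<in> rules \<Longrightarrow> b \<in> Qs \<times> lists \<Gamma> \<and> c \<in> Qs \<times> lists \<Gamma>"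
    and rules_bounded: "(l, b, c) \<in> rules \<Longrightarrow> length (snd b) \<le> N \<and> length (snd c) \<le> N"
begin

definition words :: "('q \<times> 'a list) set" where
  "words = Qs \<times> lists \<Gamma>"

lemma append_word_in_words [simp]: "b \<cdot> s \<in> words \<longleftrightarrow> b \<in> words \<and> s \<in> lists \<Gamma>"
  by (cases b) (auto simp: append_word_def words_def)

lemma rule_words: "(l, b, c) \<in> rules \<Longrightarrow> b \<in> words \<and> c \<in> words"
  unfolding words_def by (rule rules_words)

text \<open>
  The labels of a run are read from right to left, because in a product of permutations the last
  factor acts first.
\<close>

inductive run :: "'t list \<Rightarrow> 'q \<times> 'a list \<Rightarrow> 'q \<times> 'a list \<Rightarrow> bool" where
  run_Nil: "b \<in> words \<Longrightarrow> run [] b b"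
| run_Cons: "run w b (c \<cdot> v) \<Longrightarrow> (l, c, d) \<in> rules \<Longrightarrow> run (l # w) b (d \<cdot> v)"

lemma run_words: "run w b c \<Longrightarrow> b \<in> words \<and> c \<in> words"
proof (induction rule: run.induct)
  case (run_Cons w b c v l d)
  then show ?case
    unfolding append_word_in_words using rule_words by blast
qed simp

lemma run_trans:
  assumes "run w c d" and "run u b c"
  shows "run (w @ u) b d"
  using assms by induction (auto intro: run.run_Cons)

lemma run_extend:
  assumes "run w b c" and "s \<in> lists \<Gamma>"
  shows "run w (b \<cdot> s) (c \<cdot> s)"
  using assms
proof induction
  case (run_Nil b)
  then have "b \<cdot> s \<in> words" by simp
  then show ?case by (rule run.run_Nil)
next
  case (run_Cons w b c v l d)
  then show ?case
    using run.run_Cons[of w "b \<cdot> s" c "v @ s" l d] by simp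
qed

lemma run_rule:
  assumes "(l, c, d) \<in> rules" and "v \<in> lists \<Gamma>"
  shows "run [l] (c \<cdot> v) (d \<cdot> v)"
proof -
  have "c \<cdot> v \<in> words" unfolding append_word_in_words using assms rule_words by blast
  then show ?thesis using assms(1) run_Nil run_Cons by metis
qed

text \<open>
  Either a run never uses the letters of the suffix \<open>s\<close>, or it can be cut before the first step that
  does. At that moment the letters above \<open>s\<close> form a proper prefix of the left-hand side of a rule, so
  there are fewer than \<open>N\<close> of them.
\<close>

lemma run_first_touch:
  assumes "run z (e \<cdot> s) d"
  shows "(\<exists>f. d = f \<cdot> s \<and> run z e f) \<or>
         (\<exists>x z' e'. z = z' @ x \<and> run x e e' \<and> length (snd e') < N \<and> run z' (e' \<cdot> s) d)"
  using assms
proof (induction z "e \<cdot> s" d rule: run.induct)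
  case run_Nil
  then have "e \<in> words" by simp
  then show ?case using run.run_Nil by blast
next
  case (run_Cons w c v l d)
  from run_Cons.hyps(2) show ?case
  proof (elim disjE exE conjE)
    fix x z' e'
    assume "w = z' @ x" "run x e e'" "length (snd e') < N" "run z' (e' \<cdot> s) (c \<cdot> v)"
    then show ?thesis
      using run.run_Cons[OF _ run_Cons.hyps(3)] by (metis append_Cons)
  next
    fix f assume f: "c \<cdot> v = f \<cdot> s" "run w e f"
    show ?thesis
    proof (cases "length (snd c) \<le> length (snd f)")
      case True
      from append_word_eq_append_word[OF f(1) True] obtain u where u: "f = c \<cdot> u" "v = u @ s" .
      have "run (l # w) e (d \<cdot> u)"
        using f(2) run_Cons.hyps(3) u(1) by (auto intro: run.run_Cons)
      then show ?thesis using u(2) by (intro disjI1 exI[of _ "d \<cdot> u"]) simp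
    next
      case False
      then have "length (snd f) < N"
        using rules_bounded[OF run_Cons.hyps(3)] by simp
      moreover have "v \<in> lists \<Gamma>"
        using run_words[OF run_Cons.hyps(1)] append_word_in_words[of c v] by blast
      then have "run [l] (f \<cdot> s) (d \<cdot> v)"
        using run_rule[OF run_Cons.hyps(3), of v] by (simp only: f(1))
      moreover have "l # w = [l] @ w" by simp
      ultimately show ?thesis using f(2) by blast
    qed
  qed
qed

text \<open>
  The mirror image of \<open>run_first_touch\<close>: the run is cut after the last step in which the suffix \<open>s\<close>
  is produced or used. What lies above \<open>s\<close> at that moment is a proper prefix of the right-hand side
  of a rule.
\<close>

lemma run_last_touch:
  assumes "run z d (f \<cdot> s)"
  shows "(\<exists>e. d = e \<cdot> s \<and> run z e f) \<or>
         (\<exists>y z' f'. z = y @ z' \<and> run y f' f \<and> length (snd f') < N \<and> run z' d (f' \<cdot> s))"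
  using assms
proof (induction z d "f \<cdot> s" arbitrary: f rule: run.induct)
  case run_Nil
  then have "f \<in> words" by simp
  then show ?case using run.run_Nil by blast
next
  case (run_Cons w b c v l d)
  show ?case
  proof (cases "length (snd d) \<le> length (snd f)")
    case True
    from append_word_eq_append_word[OF run_Cons.hyps(4) True]
    obtain u where u: "f = d \<cdot> u" "v = u @ s" .
    have "(\<exists>e. b = e \<cdot> s \<and> run w e (c \<cdot> u)) \<or>
        (\<exists>y z' f'. w = y @ z' \<and> run y f' (c \<cdot> u) \<and> length (snd f') < N \<and> run z' b (f' \<cdot> s))"
      using run_Cons.hyps(2)[of "c \<cdot> u"] u(2) by simp
    then show ?thesis
    proof (elim disjE exE conjE)
      fix e assume "b = e \<cdot> s" "run w e (c \<cdot> u)"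
      then show ?thesis using run.run_Cons[OF _ run_Cons.hyps(3)] u(1) by blast
    next
      fix y z' f'
      assume "w = y @ z'" "run y f' (c \<cdot> u)" "length (snd f') < N" "run z' b (f' \<cdot> s)"
      then show ?thesis
        using run.run_Cons[OF _ run_Cons.hyps(3)] u(1) by (metis append_Cons)
    qed
  next
    case False
    then have "length (snd f) < N"
      using rules_bounded[OF run_Cons.hyps(3)] by simp
    moreover have r: "run (l # w) b (f \<cdot> s)"
      using run.run_Cons[OF run_Cons.hyps(1,3)] run_Cons.hyps(4) by simp
    moreover have "run [] f f"
      using run_words[OF r] unfolding append_word_in_words by (blast intro: run.run_Nil)
    ultimately show ?thesis by (metis append_Nil)
  qed
qed

definition bounded_words :: "('q \<times> 'a list) set" where
  "bounded_words = {b \<in> words. length (snd b) \<le> N}"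

lemma bounded_words_snoc:
  "b \<cdot> [a] \<in> bounded_words \<longleftrightarrow> b \<in> words \<and> length (snd b) < N \<and> a \<in> \<Gamma>"
  by (auto simp: bounded_words_def)

text \<open>
  The productions for \<open>Run\<close> are the usual ones for a pushdown automaton: the last letter of the final
  word is either left alone or cut off at its last touch. In \<open>Run_Above\<close> the common suffix \<open>s\<close> is
  guessed from its top letter down: what happens before the first touch and after the last
  touch of \<open>s\<close> is split off on both sides. This is possible because a run from \<open>e \<cdot> s\<close> to \<open>f \<cdot> s\<close>
  consumes the letters of \<open>s\<close> in the opposite order to that in which it restores them, so that the
  comparison of the two copies is a nested one. In \<open>Run_From\<close> and
  \<open>Run_To\<close> nothing has to be compared, so the two ends of the run are generated independently.
\<close>

inductive productions :: "('q, 'a) variable \<Rightarrow> (('q, 'a) variable, 't) symbol list \<Rightarrow> bool" where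
  Run_refl: "b \<in> bounded_words \<Longrightarrow> productions (Run b b) []"
| Run_step: "b \<in> bounded_words \<Longrightarrow> (l, c, d) \<in> rules \<Longrightarrow> productions (Run b d) [Tm l, Nt (Run b c)]"
| Run_lift: "b \<cdot> [a] \<in> bounded_words \<Longrightarrow> c \<cdot> [a] \<in> bounded_words \<Longrightarrow>
    productions (Run (b \<cdot> [a]) (c \<cdot> [a])) [Nt (Run b c)]"
| Run_split: "b \<in> bounded_words \<Longrightarrow> c \<cdot> [a] \<in> bounded_words \<Longrightarrow> e \<cdot> [a] \<in> bounded_words \<Longrightarrow>
    productions (Run b (c \<cdot> [a])) [Nt (Run e c), Nt (Run b (e \<cdot> [a]))]"
| Run_Above_Run: "e \<in> bounded_words \<Longrightarrow> f \<in> bounded_words \<Longrightarrow>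
    productions (Run_Above e f) [Nt (Run e f)]"
| Run_Above_split: "e \<in> bounded_words \<Longrightarrow> f \<in> bounded_words \<Longrightarrow>
    e' \<cdot> [a] \<in> bounded_words \<Longrightarrow> f' \<cdot> [a] \<in> bounded_words \<Longrightarrow>
    productions (Run_Above e f) [Nt (Run f' f), Nt (Run_Above (e' \<cdot> [a]) (f' \<cdot> [a])), Nt (Run e e')]"
| Run_From_Run: "b \<in> bounded_words \<Longrightarrow> e \<in> bounded_words \<Longrightarrow>
    productions (Run_From (end_mark b) e) [Nt (Run b e)]"
| Run_From_split: "e \<in> bounded_words \<Longrightarrow> e' \<cdot> [a] \<in> bounded_words \<Longrightarrow> k \<in> Qs <+> \<Gamma> \<Longrightarrow>
    productions (Run_From (Inr a) e) [Nt (Run (e' \<cdot> [a]) e), Nt (Run_From k e')]"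
| Run_To_Run: "f \<in> bounded_words \<Longrightarrow> c \<in> bounded_words \<Longrightarrow>
    productions (Run_To f (end_mark c)) [Nt (Run f c)]"
| Run_To_split: "f \<in> bounded_words \<Longrightarrow> f' \<cdot> [a] \<in> bounded_words \<Longrightarrow> k \<in> Qs <+> \<Gamma> \<Longrightarrow>
    productions (Run_To f (Inr a)) [Nt (Run_To f' k), Nt (Run f (f' \<cdot> [a]))]"
| Start: "e \<in> bounded_words \<Longrightarrow> f \<in> bounded_words \<Longrightarrow> j \<in> Qs <+> \<Gamma> \<Longrightarrow> k \<in> Qs <+> \<Gamma> \<Longrightarrow> j \<noteq> k \<Longrightarrow>
    productions Start [Nt (Run_To f k), Nt (Run_Above e f), Nt (Run_From j e)]"

abbreviation grammar :: "(('q, 'a) variable, 't) productions" where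
  "grammar \<equiv> {(A, \<alpha>). productions A \<alpha>}"

lemma finite_bounded_words: "finite bounded_words"
proof (rule finite_subset)
  show "bounded_words \<subseteq> Qs \<times> {u. set u \<subseteq> \<Gamma> \<and> length u \<le> N}"
    by (auto simp: bounded_words_def words_def)
qed (use finite_states finite_alphabet in \<open>simp add: finite_lists_length_le\<close>)

lemma end_mark_in: "b \<in> words \<Longrightarrow> end_mark b \<in> Qs <+> \<Gamma>"
  by (cases b rule: append_word_last_cases) (auto simp: end_mark_def words_def mem_Times_iff)

lemma finite_grammar: "finite grammar"
proof -
  let ?W = bounded_words and ?K = "Qs <+> \<Gamma>"
  define V where "V = {Start} \<union> (\<lambda>(b, c). Run b c) ` (?W \<times> ?W) \<union> (\<lambda>(b, c). Run_Above b c) ` (?W \<times> ?W)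
    \<union> (\<lambda>(k, e). Run_From k e) ` (?K \<times> ?W) \<union> (\<lambda>(f, k). Run_To f k) ` (?W \<times> ?K)"
  define Y where "Y = Nt ` V \<union> Tm ` fst ` rules"
  have V: "Start \<in> V" "\<And>b c. Run b c \<in> V \<longleftrightarrow> b \<in> ?W \<and> c \<in> ?W"
      "\<And>b c. Run_Above b c \<in> V \<longleftrightarrow> b \<in> ?W \<and> c \<in> ?W"
      "\<And>k c. Run_From k c \<in> V \<longleftrightarrow> k \<in> ?K \<and> c \<in> ?W"
      "\<And>b k. Run_To b k \<in> V \<longleftrightarrow> b \<in> ?W \<and> k \<in> ?K"
    unfolding V_def by auto
  have Y: "\<And>A. Nt A \<in> Y \<longleftrightarrow> A \<in> V" "\<And>l b c. (l, b, c) \<in> rules \<Longrightarrow> Tm l \<in> Y"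
    unfolding Y_def by force+
  have prefix: "\<And>b a. b \<cdot> [a] \<in> ?W \<Longrightarrow> b \<in> ?W \<and> a \<in> \<Gamma>"
    by (auto simp: bounded_words_def)
  have rule: "\<And>l b c. (l, b, c) \<in> rules \<Longrightarrow> b \<in> ?W \<and> c \<in> ?W"
    unfolding bounded_words_def using rule_words rules_bounded by blast
  have end_mark: "\<And>b. b \<in> ?W \<Longrightarrow> end_mark b \<in> ?K"
    using end_mark_in by (auto simp: bounded_words_def)
  have "A \<in> V \<and> set \<alpha> \<subseteq> Y \<and> length \<alpha> \<le> 3" if "productions A \<alpha>" for A \<alpha>
    using that
    by cases (simp_all add: V Y(1), (blast dest: prefix rule intro: end_mark Y(2))+)
  then have "grammar \<subseteq> V \<times> {\<alpha>. set \<alpha> \<subseteq> Y \<and> length \<alpha> \<le> 3}"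
    by blast
  moreover have "finite V" "finite Y"
    unfolding V_def Y_def
    using finite_bounded_words finite_states finite_alphabet finite_rules by auto
  moreover from this have "finite (V \<times> {\<alpha>. set \<alpha> \<subseteq> Y \<and> length \<alpha> \<le> 3})"
    using finite_lists_length_le by blast
  ultimately show ?thesis using finite_subset by blast
qed

fun denotation :: "('q, 'a) variable \<Rightarrow> 't list set" where
  "denotation Start = {w. \<exists>b c. run w b c \<and> b \<noteq> c}"
| "denotation (Run b c) = {w. run w b c}"
| "denotation (Run_Above e f) = {w. \<exists>s. run w (e \<cdot> s) (f \<cdot> s)}"
| "denotation (Run_From k e) = {w. \<exists>b. run w b e \<and> end_mark b = k}"
| "denotation (Run_To f k) = {w. \<exists>c. run w f c \<and> end_mark c = k}"

lemma form_language_two: "form_language L [Nt A, Nt B] = {u @ v | u v. u \<in> L A \<and> v \<in> L B}"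
  by auto

lemma form_language_three:
  "form_language L [Nt A, Nt B, Nt C] = {u @ v @ w | u v w. u \<in> L A \<and> v \<in> L B \<and> w \<in> L C}"
  by auto

lemma grammar_sound:
  assumes "productions A \<alpha>"
  shows "form_language denotation \<alpha> \<subseteq> denotation A"
  using assms
proof cases
  case (Run_refl b)
  then show ?thesis by (auto simp: bounded_words_def intro: run_Nil)
next
  case (Run_step b l c d)
  then show ?thesis using run_Cons[of _ b c "[]" l d] by auto
next
  case (Run_lift b a c)
  then show ?thesis by (auto simp: bounded_words_snoc intro: run_extend)
next
  case (Run_split b c a e)
  have "run (x @ y) b (c \<cdot> [a])" if "run x e c" "run y b (e \<cdot> [a])" for x y
    using run_trans[OF run_extend[OF that(1)] that(2)] Run_split(4)
    unfolding bounded_words_snoc by simp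
  then show ?thesis unfolding Run_split form_language_two by auto
next
  case (Run_Above_Run e f)
  then show ?thesis by auto (metis append_word_simps(3))
next
  case (Run_Above_split e f e' a f')
  have "run (x @ y @ z) (e \<cdot> (a # s)) (f \<cdot> (a # s))"
    if "run x f' f" "run y (e' \<cdot> (a # s)) (f' \<cdot> (a # s))" "run z e e'" for x y z s
  proof -
    have "a # s \<in> lists \<Gamma>"
      using run_words[OF that(2)] unfolding append_word_in_words by blast
    then show ?thesis using that by (blast intro: run_trans run_extend)
  qed
  then show ?thesis unfolding Run_Above_split form_language_three by auto blast
next
  case (Run_From_Run b e)
  then show ?thesis by (auto simp del: split_paired_Ex)
next
  case (Run_From_split e e' a k)
  have "\<exists>b. run (x @ y) b e \<and> end_mark b = Inr a"
    if "run x (e' \<cdot> [a]) e" "run y b e'" for x y b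
  proof -
    have a: "[a] \<in> lists \<Gamma>" using Run_From_split(4) unfolding bounded_words_snoc by simp
    then show ?thesis
      using run_trans[OF that(1) run_extend[OF that(2) a]]
      by (intro exI[of _ "b \<cdot> [a]"]) simp
  qed
  then show ?thesis unfolding Run_From_split form_language_two
    by (auto simp del: split_paired_Ex)
next
  case (Run_To_Run f c)
  then show ?thesis by (auto simp del: split_paired_Ex)
next
  case (Run_To_split f f' a k)
  have "\<exists>c. run (x @ y) f c \<and> end_mark c = Inr a"
    if "run y f (f' \<cdot> [a])" "run x f' c" for x y c
  proof -
    have a: "[a] \<in> lists \<Gamma>" using Run_To_split(4) unfolding bounded_words_snoc by simp
    then show ?thesis
      using run_trans[OF run_extend[OF that(2) a] that(1)]
      by (intro exI[of _ "c \<cdot> [a]"]) simp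
  qed
  then show ?thesis unfolding Run_To_split form_language_two
    by (auto simp del: split_paired_Ex)
next
  case (Start e f j k)
  have "\<exists>b c. run (x @ y @ z) b c \<and> b \<noteq> c"
    if "run x f c" "end_mark c = k" "run y (e \<cdot> s) (f \<cdot> s)" "run z b e" "end_mark b = j" for x y z b c s
  proof -
    have "s \<in> lists \<Gamma>"
      using run_words[OF that(3)] unfolding append_word_in_words by blast
    then show ?thesis
      using run_trans[OF run_extend[OF that(1)] run_trans[OF that(3) run_extend[OF that(4)]]]
        end_mark_neq_append_word[of b c s] that(2,5) \<open>j \<noteq> k\<close>
      by (intro exI[of _ "b \<cdot> s"] exI[of _ "c \<cdot> s"]) simp
  qed
  then show ?thesis unfolding Start form_language_three
    by (auto simp del: split_paired_Ex)
qed

abbreviation generated :: "('q, 'a) variable \<Rightarrow> 't list set" where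
  "generated \<equiv> cfg_language grammar"

lemma generatedI:
  assumes "productions A \<alpha>" and "w \<in> form_language generated \<alpha>"
  shows "w \<in> generated A"
  using yieldsI[of A \<alpha> grammar] assms by simp

lemma generated_two:
  assumes "productions A [Nt B, Nt C]" and "u \<in> generated B" and "v \<in> generated C"
  shows "u @ v \<in> generated A"
  using generatedI[OF assms(1)] assms(2,3) unfolding form_language_two by blast

lemma generated_three:
  assumes "productions A [Nt B, Nt C, Nt D]"
    and "u \<in> generated B" and "v \<in> generated C" and "w \<in> generated D"
  shows "u @ v @ w \<in> generated A"
  using generatedI[OF assms(1)] assms(2-) unfolding form_language_three by blast

lemma run_bounded_prefix:
  assumes "run w b c" and "length (snd b) < N" and "a \<in> \<Gamma>"
  shows "b \<cdot> [a] \<in> bounded_words"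
  using run_words[OF assms(1)] assms(2,3) bounded_words_snoc by blast

text \<open>
  The induction is lexicographic in the length of the label and that of the final word; as final words
  have length at most \<open>N\<close>, the two can be combined in one number.
\<close>

lemma generated_Run:
  assumes "run w b c" and "b \<in> bounded_words" and "c \<in> bounded_words"
  shows "w \<in> generated (Run b c)"
  using assms
proof (induction "length w * Suc N + length (snd c)" arbitrary: w b c rule: less_induct)
  case less
  have shorter: "length u * Suc N + length (snd e) < length w * Suc N + length (snd c)"
    if "length u < length w" "e \<in> bounded_words" for u :: "'t list" and e
  proof -
    have "Suc (length u) * Suc N \<le> length w * Suc N"
      using that(1) by (intro mult_le_mono1) simp
    moreover have "length (snd e) \<le> N" using that(2) by (simp add: bounded_words_def)
    ultimately show ?thesis by simp
  qed
  from less.prems(1) show ?case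
  proof cases
    case run_Nil
    then show ?thesis using generatedI[OF productions.Run_refl] less.prems by simp
  next
    case (run_Cons w' p v l d)
    show ?thesis
    proof (cases v rule: rev_exhaust)
      case Nil
      have "p \<in> bounded_words"
        using rule_words rules_bounded run_Cons(4) by (auto simp: bounded_words_def)
      then have "w' \<in> generated (Run b p)"
        using less.hyps[OF shorter[of w' p], of b] run_Cons less.prems Nil by simp
      then show ?thesis
        using generatedI[OF productions.Run_step[OF less.prems(2) run_Cons(4)], of w]
          run_Cons(1,2) Nil by simp
    next
      case (snoc v' a)
      define c' where "c' = d \<cdot> v'"
      have c: "c = c' \<cdot> [a]" and c': "c' \<in> bounded_words" "a \<in> \<Gamma>"
        using less.prems(3) run_Cons(2) snoc by (auto simp: c'_def bounded_words_def)
      have step: "run (l # u) e c'" if "run u e (p \<cdot> v')" for u e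
        unfolding c'_def using that run_Cons(4) by (rule run.run_Cons)
      have "run w' b ((p \<cdot> v') \<cdot> [a])" using run_Cons(3) snoc by simp
      from run_last_touch[OF this] show ?thesis
      proof (elim disjE exE conjE)
        fix e assume e: "b = e \<cdot> [a]" "run w' e (p \<cdot> v')"
        then have "e \<in> bounded_words"
          using less.prems(2) by (auto simp: bounded_words_def)
        then have "w \<in> generated (Run e c')"
          using less.hyps[of w c' e] step[OF e(2)] run_Cons(1) c c' by simp
        then show ?thesis
          using generatedI[OF productions.Run_lift[of e a c'], of w] less.prems e(1) c by simp
      next
        fix y z f
        assume t: "w' = y @ z" "run y f (p \<cdot> v')" "length (snd f) < N" "run z b (f \<cdot> [a])"
        have f: "f \<cdot> [a] \<in> bounded_words" "f \<in> bounded_words"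
          using run_bounded_prefix[OF t(2,3) c'(2)] by (auto simp: bounded_words_def)
        have "l # y \<in> generated (Run f c')"
        proof (rule less.hyps[OF _ step[OF t(2)] f(2) c'(1)])
          have "length (l # y) * Suc N \<le> length w * Suc N"
            using run_Cons(1) t(1) by (intro mult_le_mono1) simp
          then show "length (l # y) * Suc N + length (snd c') < length w * Suc N + length (snd c)"
            unfolding c by simp
        qed
        moreover have "z \<in> generated (Run b (f \<cdot> [a]))"
          using less.hyps[OF shorter t(4)] run_Cons(1) t(1) f(1) less.prems(2) by simp
        ultimately show ?thesis
          using generated_two[OF productions.Run_split[of b c' a f]] less.prems f(1) c
            run_Cons(1) t(1) by (metis append_Cons)
      qed
    qed
  qed
qed

lemma generated_Run_Above:
  assumes "run z (e \<cdot> s) (f \<cdot> s)" and "e \<in> bounded_words" and "f \<in> bounded_words"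
  shows "z \<in> generated (Run_Above e f)"
  using assms
proof (induction s arbitrary: z e f)
  case Nil
  then show ?case
    using generatedI[OF productions.Run_Above_Run] generated_Run by simp
next
  case (Cons a s)
  have direct: ?case if "run z e f"
    using generatedI[OF productions.Run_Above_Run] generated_Run[OF that] Cons.prems by simp
  have a: "a \<in> \<Gamma>"
    using run_words[OF Cons.prems(1)] unfolding append_word_in_words by simp
  from run_first_touch[OF Cons.prems(1)] show ?case
  proof (elim disjE exE conjE)
    fix g assume "f \<cdot> (a # s) = g \<cdot> (a # s)" "run z e g"
    then show ?thesis using direct by simp
  next
    fix x z' e'
    assume first: "z = z' @ x" "run x e e'" "length (snd e') < N" "run z' (e' \<cdot> (a # s)) (f \<cdot> (a # s))"
    have e': "e' \<cdot> [a] \<in> bounded_words" "e' \<in> bounded_words"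
      using first(2,3) run_words[OF first(2)] a by (auto simp: bounded_words_def)
    from run_last_touch[OF first(4)] show ?thesis
    proof (elim disjE exE conjE)
      fix g assume "e' \<cdot> (a # s) = g \<cdot> (a # s)" "run z' g f"
      then show ?thesis using direct run_trans first(1,2) by simp
    next
      fix y z'' f'
      assume last: "z' = y @ z''" "run y f' f" "length (snd f') < N"
          "run z'' (e' \<cdot> (a # s)) (f' \<cdot> (a # s))"
      have f': "f' \<cdot> [a] \<in> bounded_words" "f' \<in> bounded_words"
        using run_bounded_prefix[OF last(2,3) a] by (auto simp: bounded_words_def)
      have "z'' \<in> generated (Run_Above (e' \<cdot> [a]) (f' \<cdot> [a]))"
        using Cons.IH[OF _ e'(1) f'(1)] last(4) by simp
      then show ?thesis
        unfolding first(1) last(1)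
        using generated_three[OF productions.Run_Above_split[OF Cons.prems(2,3) e'(1) f'(1)]]
          generated_Run[OF last(2) f'(2) Cons.prems(3)] generated_Run[OF first(2) Cons.prems(2) e'(2)]
        by simp
    qed
  qed
qed

lemma generated_Run_From:
  assumes "run x b e" and "e \<in> bounded_words"
  shows "x \<in> generated (Run_From (end_mark b) e)"
  using assms
proof (induction "length (snd b)" arbitrary: x b e rule: less_induct)
  case less
  note words = run_words[OF less.prems(1)]
  show ?case
  proof (cases "b \<in> bounded_words")
    case True
    then show ?thesis
      using generatedI[OF productions.Run_From_Run] generated_Run less.prems by simp
  next
    case False
    with words have "snd b \<noteq> []" by (auto simp: bounded_words_def)
    then obtain b' a where b: "b = b' \<cdot> [a]"
      by (cases b rule: append_word_last_cases) auto
    have b': "b' \<in> words" "a \<in> \<Gamma>" using words b by auto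
    have split: ?thesis
      if "x = z @ u" "run u b' e'" "e' \<in> bounded_words" "e' \<cdot> [a] \<in> bounded_words"
        "run z (e' \<cdot> [a]) e" for z u e'
    proof -
      have "u \<in> generated (Run_From (end_mark b') e')"
        using less.hyps[of b' u e'] that b by simp
      then show ?thesis
        using generated_two[OF productions.Run_From_split[OF less.prems(2) that(4)]]
          generated_Run[OF that(5,4) less.prems(2)] end_mark_in[OF b'(1)] that(1) b by simp
    qed
    from run_first_touch[OF less.prems(1)[unfolded b]] show ?thesis
    proof (elim disjE exE conjE)
      fix z u e'
      assume t: "x = z @ u" "run u b' e'" "length (snd e') < N" "run z (e' \<cdot> [a]) e"
      have "e' \<cdot> [a] \<in> bounded_words" "e' \<in> bounded_words"
        using run_words[OF t(2)] t(3) b'(2) by (auto simp: bounded_words_def)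
      then show ?thesis using split t by blast
    next
      fix f assume "e = f \<cdot> [a]" "run x b' f"
      moreover from this have "f \<in> bounded_words"
        using less.prems(2) by (auto simp: bounded_words_def)
      ultimately show ?thesis
        using split[of "[]" x f] less.prems(2) run_Nil[of e] by (auto simp: bounded_words_def)
    qed
  qed
qed

lemma generated_Run_To:
  assumes "run y f c" and "f \<in> bounded_words"
  shows "y \<in> generated (Run_To f (end_mark c))"
  using assms
proof (induction "length (snd c)" arbitrary: y f c rule: less_induct)
  case less
  note words = run_words[OF less.prems(1)]
  show ?case
  proof (cases "c \<in> bounded_words")
    case True
    then show ?thesis
      using generatedI[OF productions.Run_To_Run] generated_Run less.prems by simp
  next
    case False
    with words have "snd c \<noteq> []" by (auto simp: bounded_words_def)
    then obtain c' a where c: "c = c' \<cdot> [a]"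
      by (cases c rule: append_word_last_cases) auto
    have c': "c' \<in> words" "a \<in> \<Gamma>" using words c by auto
    have split: ?thesis
      if "y = u @ z" "run u f' c'" "f' \<in> bounded_words" "f' \<cdot> [a] \<in> bounded_words"
        "run z f (f' \<cdot> [a])" for z u f'
    proof -
      have "u \<in> generated (Run_To f' (end_mark c'))"
        using less.hyps[of c' u f'] that c by simp
      then show ?thesis
        using generated_two[OF productions.Run_To_split[OF less.prems(2) that(4)]]
          generated_Run[OF that(5) less.prems(2) that(4)] end_mark_in[OF c'(1)] that(1) c by simp
    qed
    from run_last_touch[OF less.prems(1)[unfolded c]] show ?thesis
    proof (elim disjE exE conjE)
      fix u z f'
      assume t: "y = u @ z" "run u f' c'" "length (snd f') < N" "run z f (f' \<cdot> [a])"
      have "f' \<cdot> [a] \<in> bounded_words" "f' \<in> bounded_words"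
        using run_words[OF t(2)] t(3) c'(2) by (auto simp: bounded_words_def)
      then show ?thesis using split t by blast
    next
      fix e assume "f = e \<cdot> [a]" "run y e c'"
      moreover from this have "e \<in> bounded_words"
        using less.prems(2) by (auto simp: bounded_words_def)
      ultimately show ?thesis
        using split[of y "[]" e] less.prems(2) run_Nil[of f] by (auto simp: bounded_words_def)
    qed
  qed
qed

text \<open>
  After removal of the longest common suffix \<open>s\<close> from \<open>b\<close> and \<open>c\<close>, the run is cut at the first and
  the last touch of \<open>s\<close>. The outer pieces start or end in a word with a known end mark, and the middle
  piece leads from \<open>e \<cdot> s\<close> to \<open>f \<cdot> s\<close> with \<open>e\<close> and \<open>f\<close> bounded. If \<open>s\<close> is not touched at all, the
  different end marks force the run through a bounded word, where it can be cut in two.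
\<close>

lemma generated_Start:
  assumes "run w b c" and "b \<noteq> c"
  shows "w \<in> generated Start"
proof -
  have split: "y @ z @ x \<in> generated Start"
    if "run x b' e" "e \<in> bounded_words" "run z (e \<cdot> s) (f \<cdot> s)" "f \<in> bounded_words" "run y f c'"
      "end_mark b' \<noteq> end_mark c'" for x y z b' c' e f s
    using generated_three[OF productions.Start[OF that(2,4) _ _ that(6)]]
      generated_Run_To[OF that(5,4)] generated_Run_Above[OF that(3,2,4)] generated_Run_From[OF that(1,2)]
      run_words[OF that(1)] run_words[OF that(5)] end_mark_in by blast
  have split': "y @ x \<in> generated Start"
    if "run x b' e" "e \<in> bounded_words" "run y e c'" "end_mark b' \<noteq> end_mark c'" for x y b' c' e
    using split[OF that(1,2) _ that(2,3,4), of "[]" "[]"] that(2)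
    by (simp add: run_Nil bounded_words_def)
  have untouched: "w \<in> generated Start" if r: "run w b' c'" and k: "end_mark b' \<noteq> end_mark c'" for b' c'
  proof -
    note words = run_words[OF r]
    \<comment> \<open>A word with empty stack is bounded; otherwise the last letters differ, so that of \<open>b'\<close> is
      touched.\<close>
    consider "snd b' = []" | "snd c' = []" | b0 a c0 a' where "b' = b0 \<cdot> [a]" "c' = c0 \<cdot> [a']"
      by (metis append_word_last_cases)
    then show ?thesis
    proof cases
      case 1
      then have "b' \<in> bounded_words" using words by (simp add: bounded_words_def)
      then show ?thesis using split'[of "[]" b' b' w c'] r k words by (simp add: run_Nil)
    next
      case 2
      then have "c' \<in> bounded_words" using words by (simp add: bounded_words_def)
      then show ?thesis using split'[of w b' c' "[]" c'] r k words by (simp add: run_Nil)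
    next
      case 3
      then have neq: "c' \<noteq> g \<cdot> [a]" for g using k by (metis end_mark_append_word)
      from run_first_touch[OF r[unfolded 3(1)]] neq
      obtain x z e where t: "w = z @ x" "run x b0 e" "length (snd e) < N" "run z (e \<cdot> [a]) c'"
        by blast
      have "a \<in> \<Gamma>" using words 3 by simp
      then have "run x b' (e \<cdot> [a])" "e \<cdot> [a] \<in> bounded_words"
        using t(2,3) run_words[OF t(2)] 3(1) by (auto simp: bounded_words_def intro: run_extend)
      then show ?thesis using split' t(1,4) k by blast
    qed
  qed
  obtain b' c' s where strip: "b = b' \<cdot> s" "c = c' \<cdot> s" and k: "end_mark b' \<noteq> end_mark c'"
    using strip_common_suffix[OF assms(2)] .
  from run_first_touch[OF assms(1)[unfolded strip]] show ?thesis
  proof (elim disjE exE conjE)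
    fix g assume "c' \<cdot> s = g \<cdot> s" "run w b' g"
    then show ?thesis using untouched k by simp
  next
    fix x z e
    assume first: "w = z @ x" "run x b' e" "length (snd e) < N" "run z (e \<cdot> s) (c' \<cdot> s)"
    have e: "e \<in> bounded_words" using run_words[OF first(2)] first(3) by (simp add: bounded_words_def)
    from run_last_touch[OF first(4)] show ?thesis
    proof (elim disjE exE conjE)
      fix g assume "e \<cdot> s = g \<cdot> s" "run z g c'"
      then show ?thesis using split'[OF first(2) e] k first(1) by simp
    next
      fix y z' f
      assume last: "z = y @ z'" "run y f c'" "length (snd f) < N" "run z' (e \<cdot> s) (f \<cdot> s)"
      have "f \<in> bounded_words"
        using run_words[OF last(2)] last(3) by (simp add: bounded_words_def)
      then show ?thesis using split[OF first(2) e last(4) _ last(2) k] first(1) last(1) by simp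
    qed
  qed
qed

theorem context_free_nontrivial_runs: "context_free {w. \<exists>b c. run w b c \<and> b \<noteq> c}"
proof -
  have "generated Start \<subseteq> denotation Start"
    by (rule cfg_language_subset) (use grammar_sound in simp)
  then have "{w. \<exists>b c. run w b c \<and> b \<noteq> c} = generated Start"
    using generated_Start by auto
  then show ?thesis
    using context_free_cfg_language[OF finite_grammar] by simp
qed

end

section \<open>Locally prefix-replacing bijections\<close>

lemma extend_append_word: "extend (b \<cdot> s) t = extend b (s @- t)"
  by (simp add: extend_def)

lemma extend_inject [simp]: "extend b s = extend b t \<longleftrightarrow> s = t"
  by (auto simp: extend_def)

lemma extend_eq_extend:
  assumes "extend b s = extend c t" and "length (snd b) \<le> length (snd c)"
  obtains u where "c = b \<cdot> u" "s = u @- t"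
proof -
  let ?k = "length (snd b)"
  have fst: "fst b = fst c" and snd: "snd b @- s = snd c @- t"
    using assms(1) by (simp_all add: extend_def)
  have "snd b = take ?k (snd c)"
    using arg_cong[OF snd, of "stake ?k"] assms(2) by (simp add: stake_shift)
  then have c: "snd c = snd b @ drop ?k (snd c)"
    by (metis append_take_drop_id)
  have "s = drop ?k (snd c) @- t"
    using arg_cong[OF snd, of "sdrop ?k"] assms(2) by (simp add: sdrop_shift)
  with c fst show thesis
    by (intro that[of "drop ?k (snd c)"]) (auto simp: append_word_def prod_eq_iff)
qed

locale higman_thompson_parameters =
  fixes n r :: nat
  assumes n: "n \<ge> 2" and r: "r \<ge> 1"
begin

abbreviation tails :: "nat stream set" where "tails \<equiv> streams {..<n}"
abbreviation finite_words :: "(nat \<times> nat list) set" where "finite_words \<equiv> ht_words n r"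
abbreviation \<Omega> :: "(nat \<times> nat stream) set" where "\<Omega> \<equiv> ht_Omega n r"

definition level :: "nat \<Rightarrow> (nat \<times> nat list) set" where
  "level k = {b \<in> finite_words. length (snd b) = k}"

lemma level_words: "b \<in> level k \<Longrightarrow> b \<in> finite_words"
  by (simp add: level_def)

lemma finite_level: "finite (level k)"
proof (rule finite_subset)
  show "level k \<subseteq> {..<r} \<times> {u. set u \<subseteq> {..<n} \<and> length u = k}"
    by (auto simp: level_def ht_words_def)
qed (simp add: finite_lists_length_eq)

lemma append_word_in_finite_words [simp]:
  "b \<cdot> s \<in> finite_words \<longleftrightarrow> b \<in> finite_words \<and> s \<in> lists {..<n}"
  by (auto simp: ht_words_def append_word_def mem_Times_iff)

lemma shift_in_tails [simp]: "s @- t \<in> tails \<longleftrightarrow> s \<in> lists {..<n} \<and> t \<in> tails"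
  by (auto simp: streams_iff_sset)

lemma sconst_in_tails: "a < n \<Longrightarrow> sconst a \<in> tails"
  by (simp add: streams_iff_sset)

lemma tails_nonempty: obtains t where "t \<in> tails"
  using sconst_in_tails[of 0] n by simp

lemma extend_in_Omega [simp]: "extend b t \<in> \<Omega> \<longleftrightarrow> b \<in> finite_words \<and> t \<in> tails"
  by (auto simp: ht_Omega_def ht_words_def extend_def mem_Times_iff)

lemma Omega_split:
  assumes "\<omega> \<in> \<Omega>"
  obtains b t where "b \<in> level k" "t \<in> tails" "\<omega> = extend b t"
proof
  show eq: "\<omega> = extend (fst \<omega>, stake k (snd \<omega>)) (sdrop k (snd \<omega>))"
    by (simp add: extend_def stake_sdrop)
  have "extend (fst \<omega>, stake k (snd \<omega>)) (sdrop k (snd \<omega>)) \<in> \<Omega>"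
    using assms eq by simp
  then show "(fst \<omega>, stake k (snd \<omega>)) \<in> level k" "sdrop k (snd \<omega>) \<in> tails"
    by (simp_all add: level_def)
qed

lemma level_split:
  assumes "b \<in> finite_words" and "k \<le> length (snd b)"
  obtains b' s where "b = b' \<cdot> s" "b' \<in> level k" "s \<in> lists {..<n}"
proof
  show eq: "b = (fst b, take k (snd b)) \<cdot> drop k (snd b)"
    by (simp add: append_word_def)
  then show "(fst b, take k (snd b)) \<in> level k" "drop k (snd b) \<in> lists {..<n}"
    using assms append_word_in_finite_words[of "(fst b, take k (snd b))" "drop k (snd b)"]
    by (simp_all add: level_def)
qed

lemma level_extend_inject:
  assumes "b \<in> level k" "c \<in> level k" "extend b s = extend c t"
  shows "b = c"
proof -
  have "length (snd b) = length (snd c)" using assms(1,2) by (simp add: level_def)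
  then obtain u where "c = b \<cdot> u"
    using extend_eq_extend[OF assms(3)] by (metis order_refl)
  then show ?thesis using \<open>length (snd b) = length (snd c)\<close> by simp
qed

text \<open>
  If \<open>c = b \<cdot> u\<close> with \<open>u\<close> nonempty, then any tail whose first letter differs from that of \<open>u\<close> separates
  the two words; such a tail exists because \<open>n \<ge> 2\<close>.
\<close>

lemma word_determined_by_extensions:
  assumes "\<And>t. t \<in> tails \<Longrightarrow> extend b t = extend c t"
  shows "b = c"
proof -
  have *: "b = c" if le: "length (snd b) \<le> length (snd c)"
    and eq: "\<And>t. t \<in> tails \<Longrightarrow> extend b t = extend c t" for b c :: "nat \<times> nat list"
  proof -
    have "sconst 0 \<in> tails" by (rule sconst_in_tails) (use n in simp)
    then obtain u where u: "c = b \<cdot> u"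
      using extend_eq_extend[OF eq le] by metis
    have "u = []"
    proof (cases u)
      case (Cons a v)
      define a' where "a' = (if a = 0 then 1 else 0 :: nat)"
      have "sconst a' \<in> tails" by (rule sconst_in_tails) (use n in \<open>simp add: a'_def\<close>)
      from eq[OF this] have "sconst a' = u @- sconst a'"
        unfolding u extend_append_word extend_inject .
      then have "shd (sconst a') = a" by (metis Cons shift.simps(2) stream.sel(1))
      then show ?thesis by (simp add: a'_def split: if_splits)
    qed simp
    with u show ?thesis by simp
  qed
  show ?thesis using *[of b c] *[of c b] assms by (metis nat_le_linear)
qed

text \<open>
  \<open>replaces g b c\<close>: on the cone of infinite words with prefix \<open>b\<close>, the map \<open>g\<close> replaces this prefix
  by \<open>c\<close>.
\<close>

definition replaces :: "(nat \<times> nat stream \<Rightarrow> nat \<times> nat stream) \<Rightarrow> nat \<times> nat list \<Rightarrow> nat \<times> nat list \<Rightarrow> bool"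
  where "replaces g b c \<longleftrightarrow> (\<forall>t \<in> tails. g (extend b t) = extend c t)"

lemma replaces_append:
  assumes "replaces g b c" "s \<in> lists {..<n}"
  shows "replaces g (b \<cdot> s) (c \<cdot> s)"
  using assms by (simp add: replaces_def extend_append_word)

definition replaces_at_level :: "(nat \<times> nat stream \<Rightarrow> nat \<times> nat stream) \<Rightarrow> nat \<Rightarrow> bool" where
  "replaces_at_level g k \<longleftrightarrow> (\<forall>b \<in> level k. \<exists>c \<in> finite_words. replaces g b c)"

lemma replaces_at_level_mono:
  assumes "replaces_at_level g k" and "k \<le> l"
  shows "replaces_at_level g l"
  unfolding replaces_at_level_def
proof
  fix b assume "b \<in> level l"
  then obtain b' s where b: "b = b' \<cdot> s" "b' \<in> level k" "s \<in> lists {..<n}"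
    using assms(2) by (auto simp: level_def intro: level_split[of b k])
  then obtain c where "c \<in> finite_words" "replaces g b' c"
    using assms(1) by (auto simp: replaces_at_level_def)
  then show "\<exists>c \<in> finite_words. replaces g b c"
    using b by (intro bexI[of _ "c \<cdot> s"]) (auto intro: replaces_append)
qed

text \<open>
  Koenig's lemma: barriers are bounded. Otherwise some word has, at every depth, extensions without a
  prefix in \<open>B\<close>; as there are finitely many letters, one of its children has the same property, and
  following such children yields an infinite word that has no prefix in \<open>B\<close>.
\<close>

lemma barrier_has_prefixes_at_level:
  assumes "barrier n r B"
  obtains k where "\<And>b. b \<in> level k \<Longrightarrow> \<exists>c \<in> B. \<exists>s. b = c \<cdot> s"
proof -
  define covered where "covered b \<longleftrightarrow> (\<exists>c \<in> B. \<exists>s. b = c \<cdot> s)" for b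
  have covered_append: "covered (b \<cdot> s)" if "covered b" for b s
    using that unfolding covered_def by (metis append_word_simps(4))
  define bad where "bad b \<longleftrightarrow> b \<in> finite_words \<and>
    (\<forall>k. \<exists>s \<in> lists {..<n}. length s = k \<and> \<not> covered (b \<cdot> s))" for b
  have child: "\<exists>a < n. bad (b \<cdot> [a])" if "bad b" for b
  proof (rule ccontr)
    note b = that
    assume "\<not> ?thesis"
    then have "\<forall>a < n. \<exists>k. \<forall>s \<in> lists {..<n}. length s = k \<longrightarrow> covered (b \<cdot> [a] \<cdot> s)"
      using b by (auto simp: bad_def)
    then obtain k where k: "\<And>a s. a < n \<Longrightarrow> s \<in> lists {..<n} \<Longrightarrow> length s = k a \<Longrightarrow> covered (b \<cdot> [a] \<cdot> s)"
      by metis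
    \<comment> \<open>A common depth for all children exhibits \<open>b\<close> itself as not bad.\<close>
    define K where "K = Max (k ` {..<n})"
    obtain s where s: "s \<in> lists {..<n}" "length s = Suc K" "\<not> covered (b \<cdot> s)"
      using b unfolding bad_def by blast
    then obtain a s' where s': "s = a # s'" "a < n" "s' \<in> lists {..<n}" "length s' = K"
      by (cases s) auto
    then have "k a \<le> K" by (simp add: K_def)
    then have "covered (b \<cdot> [a] \<cdot> take (k a) s')"
      using s' by (intro k) (auto dest: in_set_takeD)
    then have "covered (b \<cdot> [a] \<cdot> take (k a) s' \<cdot> drop (k a) s')"
      by (rule covered_append)
    then show False using s s' by simp
  qed
  have no_bad: "\<not> bad b" for b
  proof
    assume "bad b"
    \<comment> \<open>A path of bad words, and the infinite word along it.\<close>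
    define next_letter where "next_letter b = (SOME a. a < n \<and> bad (b \<cdot> [a]))" for b
    have next_letter: "next_letter b < n \<and> bad (b \<cdot> [next_letter b])" if "bad b" for b
      unfolding next_letter_def by (rule someI_ex) (rule child[OF that])
    define path where "path = rec_nat b (\<lambda>_ c. c \<cdot> [next_letter c])"
    have bad_path: "bad (path i)" for i
      by (induction i) (use \<open>bad b\<close> next_letter in \<open>auto simp: path_def\<close>)
    define t where "t = smap (\<lambda>i. next_letter (path i)) nats"
    have path: "path i = b \<cdot> stake i t" for i
      by (induction i) (auto simp: path_def t_def stake_Suc simp del: stake.simps(2))
    have "t \<in> tails"
      unfolding streams_iff_sset t_def stream.set_map using next_letter[OF bad_path] by blast
    then have "extend b t \<in> \<Omega>" using \<open>bad b\<close> by (simp add: bad_def)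
    then have "\<exists>c. c \<in> B \<and> extend b t \<in> extend c ` tails"
      using assms unfolding barrier_def by blast
    then obtain c t' where c: "c \<in> B" "extend b t = extend c t'" by blast
    define i where "i = length (snd c)"
    have "extend c t' = extend (path i) (sdrop i t)"
      using c(2) by (simp add: path extend_append_word stake_sdrop)
    then obtain u where "path i = c \<cdot> u"
      by (rule extend_eq_extend) (simp add: path i_def)
    then have "covered (path i)" using c(1) by (auto simp: covered_def)
    moreover obtain s where "\<not> covered (path i \<cdot> s)"
      using bad_path[of i] by (auto simp: bad_def)
    ultimately show False using covered_append by blast
  qed
  have "\<exists>k. \<forall>s \<in> lists {..<n}. length s = k \<longrightarrow> covered ((q, []) \<cdot> s)" if "q < r" for q
    using no_bad[of "(q, [])"] that by (auto simp: bad_def ht_words_def)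
  then obtain k where
    k: "\<And>q s. q < r \<Longrightarrow> s \<in> lists {..<n} \<Longrightarrow> length s = k q \<Longrightarrow> covered ((q, []) \<cdot> s)"
    by metis
  show thesis
  proof
    fix b assume b: "b \<in> level (Max (k ` {..<r}))"
    have "fst b < r" using b by (auto simp: level_def ht_words_def)
    then have "k (fst b) \<le> length (snd b)" using b by (simp add: level_def)
    then obtain b' s where b': "b = b' \<cdot> s" "b' \<in> level (k (fst b))"
      using level_split[of b "k (fst b)"] b by (metis level_words)
    have "b' = (fst b, []) \<cdot> snd b'" using b'(1) by (simp add: append_word_def)
    moreover have "snd b' \<in> lists {..<n}" "length (snd b') = k (fst b)"
      using b'(2) by (auto simp: level_def ht_words_def mem_Times_iff)
    ultimately have "covered b'" using k[OF \<open>fst b < r\<close>] by metis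
    then show "\<exists>c \<in> B. \<exists>s. b = c \<cdot> s" using covered_append b'(1) covered_def by blast
  qed
qed

lemma barrier_level: "barrier n r (level k)"
  unfolding barrier_def
proof (intro conjI ballI)
  fix \<omega> assume "\<omega> \<in> \<Omega>"
  then obtain b t where "b \<in> level k" "t \<in> tails" "\<omega> = extend b t" by (rule Omega_split)
  then show "\<exists>!b. b \<in> level k \<and> \<omega> \<in> extend b ` tails"
    by (auto dest: level_extend_inject)
qed (auto simp: level_def)

text \<open>
  Barriers can be refined to full levels. In this form the elements of the group are easy to compose,
  to invert and to restrict to smaller cones.
\<close>

lemma carrier_iff:
  "g \<in> carrier (higman_thompson n r) \<longleftrightarrow> g \<in> Bij \<Omega> \<and> (\<exists>k. replaces_at_level g k)"
proof
  assume "g \<in> carrier (higman_thompson n r)"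
  then obtain B\<^sub>1 B\<^sub>2 \<phi> where g: "barrier n r B\<^sub>1" "barrier n r B\<^sub>2" "bij_betw \<phi> B\<^sub>1 B\<^sub>2" "induced_by n r B\<^sub>1 \<phi> g"
    by (auto simp: higman_thompson_def)
  obtain k where k: "\<And>b. b \<in> level k \<Longrightarrow> \<exists>c \<in> B\<^sub>1. \<exists>s. b = c \<cdot> s"
    using barrier_has_prefixes_at_level[OF g(1)] by blast
  have "replaces_at_level g k"
    unfolding replaces_at_level_def
  proof
    fix b assume b: "b \<in> level k"
    then obtain c s where c: "c \<in> B\<^sub>1" "b = c \<cdot> s" using k by blast
    have "s \<in> lists {..<n}" using level_words[OF b] c(2) by simp
    moreover have "\<phi> c \<in> finite_words"
      using c(1) g(2,3) by (auto simp: barrier_def bij_betw_def)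
    moreover have "replaces g c (\<phi> c)"
      using g(4) c(1) by (simp add: induced_by_def replaces_def)
    ultimately show "\<exists>c \<in> finite_words. replaces g b c"
      using c(2) replaces_append by (intro bexI[of _ "\<phi> c \<cdot> s"]) auto
  qed
  then show "g \<in> Bij \<Omega> \<and> (\<exists>k. replaces_at_level g k)"
    using g(4) by (auto simp: induced_by_def)
next
  assume "g \<in> Bij \<Omega> \<and> (\<exists>k. replaces_at_level g k)"
  then obtain k where g: "g \<in> Bij \<Omega>" and "replaces_at_level g k" by blast
  then obtain \<phi> where \<phi>: "\<And>b. b \<in> level k \<Longrightarrow> \<phi> b \<in> finite_words \<and> replaces g b (\<phi> b)"
    by (metis replaces_at_level_def)
  have bij: "bij_betw g \<Omega> \<Omega>" using g by (simp add: Bij_def)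
  have apply_g: "g (extend b t) = extend (\<phi> b) t" if "b \<in> level k" "t \<in> tails" for b t
    using \<phi> that by (auto simp: replaces_def)
  have disjoint: "b = c" if "b \<in> level k" "c \<in> level k" "s \<in> tails" "t \<in> tails"
    "extend (\<phi> b) s = extend (\<phi> c) t" for b c s t
  proof -
    have "g (extend b s) = g (extend c t)" using apply_g that by simp
    moreover have "extend b s \<in> \<Omega>" "extend c t \<in> \<Omega>" using that level_words by simp_all
    ultimately have "extend b s = extend c t"
      using bij by (meson bij_betw_def inj_onD)
    then show ?thesis using level_extend_inject that by blast
  qed
  have "inj_on \<phi> (level k)"
    using disjoint tails_nonempty by (metis inj_onI)
  moreover have "barrier n r (\<phi> ` level k)"
    unfolding barrier_def
  proof (intro conjI ballI)
    fix \<omega> assume "\<omega> \<in> \<Omega>"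
    then obtain \<omega>' where "\<omega>' \<in> \<Omega>" "\<omega> = g \<omega>'"
      using bij by (metis bij_betw_imp_surj_on imageE)
    moreover obtain b t where "b \<in> level k" "t \<in> tails" "\<omega>' = extend b t"
      using Omega_split[OF \<open>\<omega>' \<in> \<Omega>\<close>] .
    ultimately have "b \<in> level k" "t \<in> tails" "\<omega> = extend (\<phi> b) t" using apply_g by simp_all
    then show "\<exists>!c. c \<in> \<phi> ` level k \<and> \<omega> \<in> extend c ` tails"
      using disjoint by (intro ex1I[of _ "\<phi> b"]) (blast, metis imageE)
  qed (use \<phi> in auto)
  moreover have "induced_by n r (level k) \<phi> g"
    using g apply_g by (simp add: induced_by_def)
  ultimately show "g \<in> carrier (higman_thompson n r)"
    using barrier_level by (auto simp: higman_thompson_def bij_betw_def)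
qed

lemma replaces_at_level_compose:
  assumes "replaces_at_level g k" and "replaces_at_level h l"
  shows "replaces_at_level (compose \<Omega> h g) (k + l)"
  unfolding replaces_at_level_def
proof
  fix b assume "b \<in> level (k + l)"
  then obtain b' s where b: "b = b' \<cdot> s" "b' \<in> level k" "s \<in> lists {..<n}"
    by (auto simp: level_def intro: level_split[of b k])
  then have len: "length s = l" using \<open>b \<in> level (k + l)\<close> by (simp add: level_def)
  obtain c where c: "c \<in> finite_words" "replaces g b' c"
    using assms(1) b(2) by (auto simp: replaces_at_level_def)
  have "c \<cdot> s \<in> finite_words" "l \<le> length (snd (c \<cdot> s))" using c b(3) len by simp_all
  then obtain d u where d: "c \<cdot> s = d \<cdot> u" "d \<in> level l" "u \<in> lists {..<n}"
    by (rule level_split)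
  then obtain e where e: "e \<in> finite_words" "replaces h d e"
    using assms(2) by (auto simp: replaces_at_level_def)
  have "replaces (compose \<Omega> h g) b (e \<cdot> u)"
    unfolding replaces_def
  proof
    fix t assume t: "t \<in> tails"
    have "extend b t \<in> \<Omega>" using t level_words[OF b(2)] b by simp
    then have "compose \<Omega> h g (extend b t) = h (g (extend b t))" by (simp add: compose_eq)
    also have "\<dots> = h (extend (d \<cdot> u) t)"
      using replaces_append[OF c(2) b(3)] t b(1) d(1) by (simp add: replaces_def)
    also have "\<dots> = extend (e \<cdot> u) t"
      using replaces_append[OF e(2) d(3)] t by (simp add: replaces_def)
    finally show "compose \<Omega> h g (extend b t) = extend (e \<cdot> u) t" .
  qed
  then show "\<exists>c \<in> finite_words. replaces (compose \<Omega> h g) b c"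
    using e(1) d(3) by (intro bexI[of _ "e \<cdot> u"]) auto
qed

text \<open>
  Beyond the length of all replacing words, a word has a prefix among them, which the inverse replaces
  back.
\<close>

lemma replaces_at_level_inverse:
  assumes "g \<in> Bij \<Omega>" and "replaces_at_level g k"
  shows "\<exists>l. replaces_at_level (\<lambda>x \<in> \<Omega>. inv_into \<Omega> g x) l"
proof -
  have bij: "bij_betw g \<Omega> \<Omega>" using assms(1) by (simp add: Bij_def)
  from assms(2) obtain \<phi> where \<phi>: "\<And>b. b \<in> level k \<Longrightarrow> \<phi> b \<in> finite_words \<and> replaces g b (\<phi> b)"
    by (metis replaces_at_level_def)
  define l where "l = Max ((length \<circ> snd \<circ> \<phi>) ` level k)"
  have "replaces_at_level (\<lambda>x \<in> \<Omega>. inv_into \<Omega> g x) l"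
    unfolding replaces_at_level_def
  proof
    fix c assume c: "c \<in> level l"
    obtain t where t: "t \<in> tails" by (rule tails_nonempty)
    have "extend c t \<in> \<Omega>" using c t level_words by simp
    then obtain \<omega> where "\<omega> \<in> \<Omega>" "g \<omega> = extend c t" using bij by (metis bij_betw_imp_surj_on imageE)
    moreover obtain b s where b: "b \<in> level k" "s \<in> tails" "\<omega> = extend b s"
      using Omega_split[OF \<open>\<omega> \<in> \<Omega>\<close>] .
    ultimately have "extend (\<phi> b) s = extend c t" using \<phi> by (auto simp: replaces_def)
    moreover have "length (snd (\<phi> b)) \<le> length (snd c)"
      using c b(1) finite_level by (auto simp: level_def l_def intro: Max_ge)
    ultimately obtain u where u: "c = \<phi> b \<cdot> u" by (rule extend_eq_extend)
    then have u_in: "u \<in> lists {..<n}" using level_words[OF c] by simp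
    have "replaces (\<lambda>x \<in> \<Omega>. inv_into \<Omega> g x) c (b \<cdot> u)"
      unfolding replaces_def
    proof
      fix t assume t: "t \<in> tails"
      have "g (extend (b \<cdot> u) t) = extend c t"
        using replaces_append[of g b "\<phi> b" u] \<phi>[OF b(1)] u u_in t by (simp add: replaces_def)
      moreover have "extend (b \<cdot> u) t \<in> \<Omega>" "extend c t \<in> \<Omega>"
        using level_words[OF b(1)] level_words[OF c] u_in t by simp_all
      ultimately show "(\<lambda>x \<in> \<Omega>. inv_into \<Omega> g x) (extend c t) = extend (b \<cdot> u) t"
        using bij by (simp add: bij_betw_def inv_into_f_eq)
    qed
    then show "\<exists>d \<in> finite_words. replaces (\<lambda>x \<in> \<Omega>. inv_into \<Omega> g x) c d"
      using level_words[OF b(1)] u_in by (intro bexI[of _ "b \<cdot> u"]) auto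
  qed
  then show ?thesis by blast
qed

lemma subgroup_BijGroup: "subgroup (carrier (higman_thompson n r)) (BijGroup \<Omega>)"
proof
  show "carrier (higman_thompson n r) \<subseteq> carrier (BijGroup \<Omega>)"
    by (auto simp: carrier_iff BijGroup_def)
next
  fix g h assume "g \<in> carrier (higman_thompson n r)" "h \<in> carrier (higman_thompson n r)"
  moreover from this have "\<exists>k. replaces_at_level (compose \<Omega> g h) k"
    using replaces_at_level_compose unfolding carrier_iff by blast
  ultimately show "g \<otimes>\<^bsub>BijGroup \<Omega>\<^esub> h \<in> carrier (higman_thompson n r)"
    by (simp add: carrier_iff BijGroup_def compose_Bij)
next
  have "replaces_at_level (\<lambda>x \<in> \<Omega>. x) 0"
    by (auto simp: replaces_at_level_def replaces_def level_def)
  then show "\<one>\<^bsub>BijGroup \<Omega>\<^esub> \<in> carrier (higman_thompson n r)"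
    by (auto simp: carrier_iff BijGroup_def id_Bij)
next
  fix g assume "g \<in> carrier (higman_thompson n r)"
  then show "inv\<^bsub>BijGroup \<Omega>\<^esub> g \<in> carrier (higman_thompson n r)"
    using replaces_at_level_inverse by (auto simp: carrier_iff inv_BijGroup restrict_inv_into_Bij)
qed

sublocale group "higman_thompson n r"
proof -
  have "higman_thompson n r = BijGroup \<Omega> \<lparr>carrier := carrier (higman_thompson n r)\<rparr>"
    by (simp add: higman_thompson_def)
  then show "group (higman_thompson n r)"
    using subgroup.subgroup_is_group[OF subgroup_BijGroup group_BijGroup] by simp
qed

abbreviation G :: "(nat \<times> nat stream \<Rightarrow> nat \<times> nat stream) monoid" where
  "G \<equiv> higman_thompson n r"

lemma mult_apply:
  assumes "g \<in> carrier G" "h \<in> carrier G" "\<omega> \<in> \<Omega>"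
  shows "(g \<otimes>\<^bsub>G\<^esub> h) \<omega> = g (h \<omega>)"
  using assms by (simp add: carrier_iff) (simp add: higman_thompson_def BijGroup_def compose_eq)

lemma one_apply: "\<omega> \<in> \<Omega> \<Longrightarrow> \<one>\<^bsub>G\<^esub> \<omega> = \<omega>"
  by (simp add: higman_thompson_def BijGroup_def)

lemma apply_in_Omega:
  assumes "g \<in> carrier G" "\<omega> \<in> \<Omega>"
  shows "g \<omega> \<in> \<Omega>"
  using assms by (auto simp: carrier_iff Bij_def bij_betw_def)

lemma carrier_eqI:
  assumes "g \<in> carrier G" "h \<in> carrier G" "\<And>\<omega>. \<omega> \<in> \<Omega> \<Longrightarrow> g \<omega> = h \<omega>"
  shows "g = h"
proof -
  have "g \<in> extensional \<Omega>" "h \<in> extensional \<Omega>"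
    using assms(1,2) by (auto simp: carrier_iff Bij_def)
  then show ?thesis using assms(3) by (rule extensionalityI)
qed

end

section \<open>The co-word problem as a set of nontrivial runs\<close>

context higman_thompson_parameters
begin

lemma letter_value_closed:
  assumes "X \<subseteq> carrier G" "l \<in> X \<times> UNIV"
  shows "letter_value G l \<in> carrier G"
  using assms by (auto simp: letter_value_def)

lemma word_value_Cons: "word_value G (l # w) = letter_value G l \<otimes>\<^bsub>G\<^esub> word_value G w"
  by (simp add: word_value_def)

lemma word_value_closed:
  assumes "X \<subseteq> carrier G" "w \<in> lists (X \<times> UNIV)"
  shows "word_value G w \<in> carrier G"
  using assms(2)
proof induction
  case Nil
  then show ?case by (simp add: word_value_def)
next
  case (Cons l w)
  then show ?case using letter_value_closed[OF assms(1)] by (simp add: word_value_Cons)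
qed

lemma replaces_mult:
  assumes "g \<in> carrier G" "h \<in> carrier G" "b \<in> finite_words"
    and "replaces g b c" "replaces h c d"
  shows "replaces (h \<otimes>\<^bsub>G\<^esub> g) b d"
  using assms by (simp add: replaces_def mult_apply)

text \<open>
  All letters replace prefixes at some common level \<open>K\<close>, which gives a finite system of rules for
  words of length \<open>K\<close>. Runs of this system compute the action of \<^const>\<open>word_value\<close> on cones,
  and on sufficiently small cones every word of letters has a run. Hence a word of letters acts
  nontrivially iff some run labelled by it leads to a different word.
\<close>

theorem coword_problem_context_free:
  assumes "finite X" and X: "X \<subseteq> carrier G"
  shows "context_free (coword_problem G X)"
proof -
  define letters where "letters = X \<times> (UNIV :: bool set)"
  have "finite letters" using assms(1) by (simp add: letters_def)
  note closed = letter_value_closed[OF X, folded letters_def] word_value_closed[OF X, folded letters_def]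
  have "\<forall>l \<in> letters. \<exists>k. replaces_at_level (letter_value G l) k"
    using closed(1) unfolding carrier_iff by blast
  then obtain k where k: "\<And>l. l \<in> letters \<Longrightarrow> replaces_at_level (letter_value G l) (k l)"
    by metis
  define K where "K = Max (k ` letters)"
  have K: "replaces_at_level (letter_value G l) K" if "l \<in> letters" for l
    using replaces_at_level_mono[OF k[OF that]] that \<open>finite letters\<close> by (simp add: K_def)
  have "\<forall>l \<in> letters. \<forall>b \<in> level K. \<exists>c. c \<in> finite_words \<and> replaces (letter_value G l) b c"
    using K unfolding replaces_at_level_def by blast
  then obtain image where image: "\<And>l b. l \<in> letters \<Longrightarrow> b \<in> level K \<Longrightarrow>
      image l b \<in> finite_words \<and> replaces (letter_value G l) b (image l b)"
    by metis
  define rules where "rules = (\<lambda>(l, b). (l, b, image l b)) ` (letters \<times> level K)"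
  have rules: "(l, b, c) \<in> rules \<longleftrightarrow> l \<in> letters \<and> b \<in> level K \<and> c = image l b" for l b c
    by (auto simp: rules_def)
  have "finite rules" using \<open>finite letters\<close> finite_level by (simp add: rules_def)
  define N where "N = Max (insert K ((\<lambda>x. length (snd (snd (snd x)))) ` rules))"
  have N: "K \<le> N" "\<And>l b c. (l, b, c) \<in> rules \<Longrightarrow> length (snd c) \<le> N"
    using \<open>finite rules\<close> unfolding N_def by (simp, intro Max_ge) (simp, force)
  interpret prefix_rewriting "{..<r}" "{..<n}" rules N
  proof
    fix l b c assume rule: "(l, b, c) \<in> rules"
    then have "b \<in> finite_words" "c \<in> finite_words" using image[of l b] level_words[of b K] by (simp_all add: rules)
    then show "b \<in> {..<r} \<times> lists {..<n} \<and> c \<in> {..<r} \<times> lists {..<n}"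
      by (simp add: ht_words_def)
    show "length (snd b) \<le> N \<and> length (snd c) \<le> N"
      using N rule by (auto simp: rules level_def)
  qed (use \<open>finite rules\<close> in auto)
  have words: "words = finite_words" by (simp add: words_def ht_words_def)
  have sound: "w \<in> lists letters \<and> replaces (word_value G w) b c" if "run w b c" for w b c
    using that
  proof induction
    case (run_Nil b)
    then show ?case by (auto simp: word_value_def replaces_def one_apply words)
  next
    case (run_Cons w b p v l d)
    have l: "l \<in> letters" "replaces (letter_value G l) p d"
      using run_Cons.hyps(2) image[of l p] by (simp_all add: rules)
    have v: "v \<in> lists {..<n}" and b: "b \<in> finite_words"
      using run_words[OF run_Cons.hyps(1)] by (simp_all add: words)
    have "replaces (word_value G (l # w)) b (d \<cdot> v)"
      unfolding word_value_Cons
      using replaces_mult[OF closed(2) closed(1) b] replaces_append[OF l(2) v] run_Cons.IH l(1) by blast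
    then show ?case using l(1) run_Cons.IH by simp
  qed
  have complete: "\<exists>m. \<forall>b \<in> finite_words. m \<le> length (snd b) \<longrightarrow> (\<exists>c. run w b c)"
    if "w \<in> lists letters" for w
    using that
  proof induction
    case Nil
    then show ?case using run_Nil words by blast
  next
    case (Cons l w)
    then obtain m where m: "\<And>b. b \<in> finite_words \<Longrightarrow> m \<le> length (snd b) \<Longrightarrow> \<exists>c. run w b c"
      by blast
    have "\<exists>c. run (l # w) b c" if b: "b \<in> finite_words" "m + K \<le> length (snd b)" for b
    proof -
      have "m \<le> length (snd b)" using b(2) by simp
      then obtain b' s where b': "b = b' \<cdot> s" "b' \<in> level m" "s \<in> lists {..<n}"
        using level_split[OF b(1)] by blast
      then have "b' \<in> finite_words" "m \<le> length (snd b')" "K \<le> length s"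
        using b(2) by (simp_all add: level_def)
      then obtain c where "run w b' c" using m by blast
      then have c: "run w b (c \<cdot> s)" "c \<cdot> s \<in> finite_words"
        using run_extend run_words words b'(1,3) by auto
      have len: "K \<le> length (snd (c \<cdot> s))" using \<open>K \<le> length s\<close> by simp
      obtain p v where p: "c \<cdot> s = p \<cdot> v" "p \<in> level K" using level_split[OF c(2) len] .
      then have "(l, p, image l p) \<in> rules" using Cons.hyps(1) rules by blast
      then show ?thesis using run_Cons c(1) p(1) by metis
    qed
    then show ?case by blast
  qed
  have "coword_problem G X = {w. \<exists>b c. run w b c \<and> b \<noteq> c}"
  proof (rule subset_antisym; rule subsetI)
    fix w assume "w \<in> coword_problem G X"
    then have w: "w \<in> lists letters" "word_value G w \<noteq> \<one>\<^bsub>G\<^esub>"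
      by (auto simp: coword_problem_def word_problem_def letters_def)
    then obtain \<omega> where \<omega>: "\<omega> \<in> \<Omega>" "word_value G w \<omega> \<noteq> \<omega>"
      using carrier_eqI[OF closed(2)[OF w(1)] one_closed] one_apply by metis
    obtain m where "\<forall>b \<in> finite_words. m \<le> length (snd b) \<longrightarrow> (\<exists>c. run w b c)"
      using complete[OF w(1)] by blast
    moreover obtain b t where b: "b \<in> level m" "t \<in> tails" "\<omega> = extend b t"
      using Omega_split[OF \<omega>(1)] .
    ultimately obtain c where c: "run w b c" by (auto simp: level_def)
    then have "word_value G w \<omega> = extend c t" using sound b by (auto simp: replaces_def)
    with \<omega>(2) b have "b \<noteq> c" by auto
    with c show "w \<in> {w. \<exists>b c. run w b c \<and> b \<noteq> c}" by blast
  next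
    fix w assume "w \<in> {w. \<exists>b c. run w b c \<and> b \<noteq> c}"
    then obtain b c where bc: "run w b c" "b \<noteq> c" by blast
    from word_determined_by_extensions[of b c] bc(2)
    obtain t where t: "t \<in> tails" "extend b t \<noteq> extend c t" by blast
    have "extend b t \<in> \<Omega>" using run_words[OF bc(1)] t(1) words by simp
    moreover have "word_value G w (extend b t) = extend c t"
      using sound[OF bc(1)] t(1) by (simp add: replaces_def)
    ultimately have "word_value G w \<noteq> \<one>\<^bsub>G\<^esub>"
      using one_apply t(2) by metis
    then show "w \<in> coword_problem G X"
      using sound[OF bc(1)] by (auto simp: coword_problem_def word_problem_def letters_def)
  qed
  then show ?thesis using context_free_nontrivial_runs by simp
qed

end

section \<open>Finite generation by swaps of cones\<close>

text \<open>
  No common extension; equivalently, neither word is a prefix of the other.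
\<close>

definition incomparable :: "'q \<times> 'a list \<Rightarrow> 'q \<times> 'a list \<Rightarrow> bool" where
  "incomparable b c \<longleftrightarrow> (\<forall>s t. b \<cdot> s \<noteq> c \<cdot> t)"

lemma incomparable_sym: "incomparable b c \<Longrightarrow> incomparable c b"
  unfolding incomparable_def by metis

lemma incomparable_append: "incomparable b c \<Longrightarrow> incomparable (b \<cdot> s) (c \<cdot> t)"
  unfolding incomparable_def by simp

lemma incomparable_append_left: "incomparable b c \<Longrightarrow> incomparable (b \<cdot> s) c"
  using incomparable_append[of b c s "[]"] by simp

lemma comparable_cases:
  assumes "\<not> incomparable b c"
  obtains u where "c = b \<cdot> u" | u where "b = c \<cdot> u"
proof -
  from assms obtain s t where eq: "b \<cdot> s = c \<cdot> t" by (auto simp: incomparable_def)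
  show thesis
  proof (cases "length (snd b) \<le> length (snd c)")
    case True
    then show ?thesis using append_word_eq_append_word[OF eq] that(1) by metis
  next
    case False
    then show ?thesis using append_word_eq_append_word[OF eq[symmetric]] that(2) by (metis nat_le_linear)
  qed
qed

lemma incomparable_not_prefix: "incomparable b c \<Longrightarrow> c \<noteq> b \<cdot> u"
  unfolding incomparable_def by (metis append_word_simps(3))

lemma incomparable_same_length:
  assumes "length (snd b) = length (snd c)" "b \<noteq> c"
  shows "incomparable b c"
proof (rule ccontr)
  assume "\<not> incomparable b c"
  then show False by (cases rule: comparable_cases) (use assms in auto)
qed

lemma incomparable_extend:
  assumes "incomparable b c"
  shows "extend b s \<noteq> extend c t"
proof
  assume eq: "extend b s = extend c t"
  show False
  proof (cases "length (snd b) \<le> length (snd c)")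
    case True
    then show False using extend_eq_extend[OF eq] incomparable_not_prefix[OF assms] by metis
  next
    case False
    then show False
      using extend_eq_extend[OF eq[symmetric]] incomparable_not_prefix[OF incomparable_sym[OF assms]]
      by (metis nat_le_linear)
  qed
qed

context higman_thompson_parameters
begin

text \<open>
  The involution that exchanges the cones of \<open>u\<close> and \<open>v\<close> by prefix replacement.
\<close>

definition swap :: "nat \<times> nat list \<Rightarrow> nat \<times> nat list \<Rightarrow> nat \<times> nat stream \<Rightarrow> nat \<times> nat stream" where
  "swap u v = (\<lambda>\<omega> \<in> \<Omega>.
     if \<omega> \<in> range (extend u) then extend v (sdrop (length (snd u)) (snd \<omega>))
     else if \<omega> \<in> range (extend v) then extend u (sdrop (length (snd v)) (snd \<omega>))
     else \<omega>)"

lemma sdrop_extend [simp]: "sdrop (length (snd u)) (snd (extend u t)) = t"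
  by (simp add: extend_def sdrop_shift)

lemma swap_left: "u \<in> finite_words \<Longrightarrow> t \<in> tails \<Longrightarrow> swap u v (extend u t) = extend v t"
  by (simp add: swap_def)

lemma swap_right:
  assumes "incomparable u v" "v \<in> finite_words" "t \<in> tails"
  shows "swap u v (extend v t) = extend u t"
  using assms incomparable_extend[OF assms(1)] by (auto simp: swap_def) metis

lemma swap_other:
  assumes "\<omega> \<in> \<Omega>" "\<omega> \<notin> range (extend u)" "\<omega> \<notin> range (extend v)"
  shows "swap u v \<omega> = \<omega>"
  using assms by (simp add: swap_def)

lemma in_cone_tails:
  assumes "\<omega> \<in> \<Omega>" "\<omega> \<in> range (extend u)"
  obtains t where "\<omega> = extend u t" "t \<in> tails" "u \<in> finite_words"
  using assms by auto

lemma replaces_swap: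
  assumes "incomparable u v" "u \<in> finite_words" "v \<in> finite_words"
  shows "replaces (swap u v) u v" "replaces (swap u v) v u"
    and "\<And>b. b \<in> finite_words \<Longrightarrow> incomparable b u \<Longrightarrow> incomparable b v \<Longrightarrow> replaces (swap u v) b b"
proof -
  show "replaces (swap u v) u v" "replaces (swap u v) v u"
    using assms swap_left swap_right by (simp_all add: replaces_def)
  show "replaces (swap u v) b b"
    if "b \<in> finite_words" "incomparable b u" "incomparable b v" for b
    unfolding replaces_def
  proof
    fix t assume "t \<in> tails"
    then show "swap u v (extend b t) = extend b t"
      using that(1) incomparable_extend[OF that(2)] incomparable_extend[OF that(3)]
      by (intro swap_other) auto
  qed
qed

lemma swap_closed:
  assumes uv: "incomparable u v" "u \<in> finite_words" "v \<in> finite_words"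
  shows "swap u v \<in> carrier G"
proof -
  have maps: "swap u v \<omega> \<in> \<Omega> \<and> swap u v (swap u v \<omega>) = \<omega>" if \<omega>: "\<omega> \<in> \<Omega>" for \<omega>
  proof -
    consider t where "\<omega> = extend u t" "t \<in> tails" | t where "\<omega> = extend v t" "t \<in> tails"
      | "\<omega> \<notin> range (extend u)" "\<omega> \<notin> range (extend v)"
      using in_cone_tails[OF \<omega>] by metis
    then show ?thesis
    proof cases
      case 3
      then show ?thesis using swap_other \<omega> by simp
    qed (use uv swap_left swap_right in auto)
  qed
  then have "bij_betw (swap u v) \<Omega> \<Omega>"
    by (intro bij_betw_byWitness[where f' = "swap u v"]) auto
  then have "swap u v \<in> Bij \<Omega>" by (simp add: Bij_def swap_def)
  moreover have "replaces_at_level (swap u v) (max (length (snd u)) (length (snd v)))"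
    unfolding replaces_at_level_def
  proof
    fix b assume b: "b \<in> level (max (length (snd u)) (length (snd v)))"
    consider s where "b = u \<cdot> s" | s where "b = v \<cdot> s" | "incomparable b u" "incomparable b v"
    proof (atomize_elim)
      have prefix: "\<exists>s. b = c \<cdot> s" if "\<not> incomparable b c" "length (snd c) \<le> length (snd b)" for c
        using that(1)
      proof (cases rule: comparable_cases)
        case (1 s)
        then have "s = []" using that(2) by simp
        then show ?thesis using 1 by (metis append_word_simps(3))
      qed blast
      show "(\<exists>s. b = u \<cdot> s) \<or> (\<exists>s. b = v \<cdot> s) \<or> incomparable b u \<and> incomparable b v"
        using prefix[of u] prefix[of v] b by (auto simp: level_def)
    qed
    then show "\<exists>c \<in> finite_words. replaces (swap u v) b c"
    proof cases
      case (1 s)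
      then have "s \<in> lists {..<n}" using level_words[OF b] by simp
      then show ?thesis using 1 replaces_append[OF replaces_swap(1)[OF uv]] uv(3)
        by (intro bexI[of _ "v \<cdot> s"]) auto
    next
      case (2 s)
      then have "s \<in> lists {..<n}" using level_words[OF b] by simp
      then show ?thesis using 2 replaces_append[OF replaces_swap(2)[OF uv]] uv(2)
        by (intro bexI[of _ "u \<cdot> s"]) auto
    next
      case 3
      then show ?thesis using replaces_swap(3)[OF uv] level_words[OF b] by blast
    qed
  qed
  ultimately show ?thesis unfolding carrier_iff by blast
qed

lemma swap_commute:
  assumes "incomparable u v"
  shows "swap u v = swap v u"
proof -
  have "\<omega> \<notin> range (extend v)" if "\<omega> \<in> range (extend u)" for \<omega>
    using that incomparable_extend[OF assms] by (auto simp del: split_paired_All)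
  then show ?thesis
    unfolding swap_def by (intro restrict_ext) simp
qed

lemma images_incomparable:
  assumes h: "h \<in> carrier G" and u: "u \<in> finite_words" "u' \<in> finite_words" "replaces h u u'"
    and v: "v \<in> finite_words" "v' \<in> finite_words" "replaces h v v'" and "incomparable u v"
  shows "incomparable u' v'"
proof (rule ccontr)
  obtain t where t: "t \<in> tails" by (rule tails_nonempty)
  have inj: "inj_on h \<Omega>" using h by (simp add: carrier_iff Bij_def bij_betw_def)
  have disjoint: "extend u' s \<noteq> extend v' s'" if "s \<in> tails" "s' \<in> tails" for s s'
  proof
    assume "extend u' s = extend v' s'"
    then have "h (extend u s) = h (extend v s')"
      using u(3) v(3) that by (simp add: replaces_def)
    moreover have "extend u s \<in> \<Omega>" "extend v s' \<in> \<Omega>" using u v that by simp_all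
    ultimately have "extend u s = extend v s'" using inj by (meson inj_onD)
    then show False using incomparable_extend assms(8) by blast
  qed
  assume "\<not> incomparable u' v'"
  then show False
  proof (cases rule: comparable_cases)
    case (1 s)
    then have "s @- t \<in> tails" using v(2) t by simp
    then show False using disjoint[of "s @- t" t] t 1 by (simp add: extend_append_word)
  next
    case (2 s)
    then have "s @- t \<in> tails" using u(2) t by simp
    then show False using disjoint[of t "s @- t"] t 2 by (simp add: extend_append_word)
  qed
qed

text \<open>
  Conjugating the swap of \<open>u'\<close> and \<open>v'\<close> by \<open>h\<close> gives the swap of two cones that \<open>h\<close> carries
  canonically to those of \<open>u'\<close> and \<open>v'\<close>. This is what shortens swaps.
\<close>

lemma swap_conjugate:
  assumes h: "h \<in> carrier G" and u: "u \<in> finite_words" "u' \<in> finite_words" "replaces h u u'"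
    and v: "v \<in> finite_words" "v' \<in> finite_words" "replaces h v v'" and uv: "incomparable u v"
  shows "swap u v = inv\<^bsub>G\<^esub> h \<otimes>\<^bsub>G\<^esub> (swap u' v' \<otimes>\<^bsub>G\<^esub> h)"
proof -
  note uv' = images_incomparable[OF assms]
  note closed = swap_closed[OF uv u(1) v(1)] swap_closed[OF uv' u(2) v(2)]
  have inj: "inj_on h \<Omega>" using h by (simp add: carrier_iff Bij_def bij_betw_def)
  have "h \<otimes>\<^bsub>G\<^esub> swap u v = swap u' v' \<otimes>\<^bsub>G\<^esub> h"
  proof (rule carrier_eqI)
    fix \<omega> assume \<omega>: "\<omega> \<in> \<Omega>"
    have "h (swap u v \<omega>) = swap u' v' (h \<omega>)"
    proof -
      consider t where "\<omega> = extend u t" "t \<in> tails" | t where "\<omega> = extend v t" "t \<in> tails"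
        | "\<omega> \<notin> range (extend u)" "\<omega> \<notin> range (extend v)"
        using in_cone_tails[OF \<omega>] by metis
      then show ?thesis
      proof cases
        case (1 t)
        then show ?thesis using u v by (simp add: swap_left replaces_def)
      next
        case (2 t)
        then show ?thesis using u v uv uv' by (simp add: swap_right replaces_def)
      next
        case 3
        have outside: "h \<omega> \<notin> range (extend c')"
          if "\<omega> \<notin> range (extend c)" "replaces h c c'" "c \<in> finite_words" for c c'
        proof
          assume "h \<omega> \<in> range (extend c')"
          then obtain t where t: "h \<omega> = extend c' t" "t \<in> tails"
            using in_cone_tails[OF apply_in_Omega[OF h \<omega>]] by metis
          then have "h \<omega> = h (extend c t)" using that(2) by (simp add: replaces_def)
          moreover have "extend c t \<in> \<Omega>" using that(3) t(2) by simp
          ultimately have "\<omega> = extend c t" using inj \<omega> by (meson inj_onD)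
          then show False using that(1) by blast
        qed
        show ?thesis
          using swap_other[OF \<omega> 3] swap_other[OF apply_in_Omega[OF h \<omega>]] outside 3 u v by simp
      qed
    qed
    then show "(h \<otimes>\<^bsub>G\<^esub> swap u v) \<omega> = (swap u' v' \<otimes>\<^bsub>G\<^esub> h) \<omega>"
      using mult_apply h closed \<omega> by simp
  qed (use h closed in auto)
  then show ?thesis using h closed by (metis inv_solve_left m_closed)
qed

definition short_swaps :: "(nat \<times> nat stream \<Rightarrow> nat \<times> nat stream) set" where
  "short_swaps = {swap u v | u v. u \<in> finite_words \<and> v \<in> finite_words \<and> incomparable u v \<and>
     length (snd u) \<le> 3 \<and> length (snd v) \<le> 3}"

lemma finite_short_swaps: "finite short_swaps"
proof (rule finite_subset)
  let ?W = "\<Union>k \<le> 3. level k"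
  show "short_swaps \<subseteq> (\<lambda>(u, v). swap u v) ` (?W \<times> ?W)"
    by (auto simp: short_swaps_def level_def)
qed (use finite_level in auto)

lemma short_swaps_closed: "short_swaps \<subseteq> carrier G"
  by (auto simp: short_swaps_def intro: swap_closed)

text \<open>
  Two incomparable candidates are at hand: one branches off from \<open>x\<close> at its first letter and one at
  its second. If the second candidate is comparable with \<open>v\<close>, it must be a prefix of \<open>v\<close>, since its proper
  prefixes are prefixes of \<open>x\<close>; then the first candidate is incomparable with \<open>v\<close>.
\<close>

lemma incomparable_word_of_length_two:
  assumes "x \<in> level 3" "incomparable v x"
  obtains y where "y \<in> level 2" "incomparable x y" "incomparable v y"
proof -
  obtain q a b c where x: "x = (q, [a, b, c])" "q < r" "a < n" "b < n"
    using assms(1) by (cases x) (auto simp: level_def ht_words_def numeral_3_eq_3 length_Suc_conv)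
  define other where "other m = (if m = 0 then 1 else 0 :: nat)" for m :: nat
  have other: "other m < n" "other m \<noteq> m" for m using n by (auto simp: other_def)
  define y\<^sub>1 where "y\<^sub>1 = (q, [a, other b])"
  define y\<^sub>2 where "y\<^sub>2 = (q, [other a, 0 :: nat])"
  have level: "y\<^sub>1 \<in> level 2" "y\<^sub>2 \<in> level 2"
    using x other n by (auto simp: level_def ht_words_def y\<^sub>1_def y\<^sub>2_def)
  have x_y: "incomparable x y\<^sub>1" "incomparable x y\<^sub>2"
    using other[of a] other[of b] by (auto simp: incomparable_def append_word_def x y\<^sub>1_def y\<^sub>2_def)
  show thesis
  proof (cases "incomparable v y\<^sub>1")
    case True
    then show thesis using that level x_y by blast
  next
    case False
    then obtain s t where st: "v \<cdot> s = y\<^sub>1 \<cdot> t" by (auto simp: incomparable_def)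
    have "\<exists>s. v = y\<^sub>1 \<cdot> s"
    proof (cases "snd v")
      case Nil
      then have "x = v \<cdot> snd x" using st by (simp add: append_word_def y\<^sub>1_def x)
      then show ?thesis using incomparable_not_prefix[OF assms(2)] by blast
    next
      case (Cons a' w)
      then have a': "a' = a" "fst v = q" using st by (auto simp: append_word_def y\<^sub>1_def)
      show ?thesis
      proof (cases w)
        case Nil
        then have "x = v \<cdot> [b, c]" using Cons a' by (simp add: append_word_def x prod_eq_iff)
        then show ?thesis using incomparable_not_prefix[OF assms(2)] by blast
      next
        case (Cons b' w')
        then have "v = y\<^sub>1 \<cdot> w'"
          using st \<open>snd v = a' # w\<close> a' by (auto simp: append_word_def y\<^sub>1_def prod_eq_iff)
        then show ?thesis by blast
      qed
    qed
    moreover have "incomparable y\<^sub>1 y\<^sub>2"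
      using other[of a] by (auto simp: incomparable_def append_word_def y\<^sub>1_def y\<^sub>2_def)
    ultimately have "incomparable v y\<^sub>2" using incomparable_append_left by blast
    then show thesis using that level x_y by blast
  qed
qed

text \<open>
  If \<open>u\<close> has length at least 4, conjugation by a short swap that moves the prefix of \<open>u\<close> of length 3
  to a word of length 2 shortens \<open>u\<close>. The word of length 2 is chosen such that \<open>v\<close> is shortened as well or
  not moved.
\<close>

lemma swap_in_generated:
  assumes "incomparable u v" "u \<in> finite_words" "v \<in> finite_words"
  shows "swap u v \<in> generate G short_swaps"
  using assms
proof (induction "length (snd u) + length (snd v)" arbitrary: u v rule: less_induct)
  case less
  have reduce: "swap u v \<in> generate G short_swaps"
    if uv: "incomparable u v" "u \<in> finite_words" "v \<in> finite_words" and long: "3 < length (snd u)"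
      and IH: "\<And>u' v'. length (snd u') + length (snd v') < length (snd u) + length (snd v) \<Longrightarrow>
        incomparable u' v' \<Longrightarrow> u' \<in> finite_words \<Longrightarrow> v' \<in> finite_words \<Longrightarrow>
        swap u' v' \<in> generate G short_swaps" for u v
  proof -
    have "3 \<le> length (snd u)" using long by simp
    then obtain x s where x: "u = x \<cdot> s" "x \<in> level 3" "s \<in> lists {..<n}"
      using level_split[OF uv(2)] by blast
    have conj: ?thesis
      if y: "y \<in> level 2" "incomparable x y" and v': "v' \<in> finite_words" "length (snd v') \<le> length (snd v)"
        "replaces (swap x y) v v'" for y v'
    proof -
      let ?h = "swap x y"
      have words: "x \<in> finite_words" "y \<in> finite_words" using x y level_words by blast+
      have "length (snd x) \<le> 3" "length (snd y) \<le> 3" using x(2) y(1) by (simp_all add: level_def)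
      then have "?h \<in> short_swaps" unfolding short_swaps_def using y(2) words by blast
      then have h: "?h \<in> generate G short_swaps" "?h \<in> carrier G"
        using short_swaps_closed by (auto intro: generate.incl)
      have u': "y \<cdot> s \<in> finite_words" "replaces ?h u (y \<cdot> s)"
        using words x y replaces_append[OF replaces_swap(1)] by simp_all
      note conjugate = h(2) uv(2) u' uv(3) v'(1,3) uv(1)
      have "length (snd (y \<cdot> s)) + length (snd v') < length (snd u) + length (snd v)"
        using x y(1) v'(2) by (simp add: level_def)
      then have "swap (y \<cdot> s) v' \<in> generate G short_swaps"
        using IH images_incomparable[OF conjugate] u'(1) v'(1) by blast
      then show ?thesis
        unfolding swap_conjugate[OF conjugate]
        using h(1) generate_m_inv_closed[OF short_swaps_closed] by (blast intro: generate.eng)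
    qed
    show ?thesis
    proof (cases "incomparable v x")
      case True
      then obtain y where y: "y \<in> level 2" "incomparable x y" "incomparable v y"
        using incomparable_word_of_length_two[OF x(2)] by blast
      then show ?thesis
        using conj[OF y(1,2) uv(3)] replaces_swap(3)[OF y(2)] x(2) uv(3) True level_words by blast
    next
      case False
      then show ?thesis
      proof (cases rule: comparable_cases)
        case (1 s')
        then have "u = v \<cdot> (s' @ s)" using x(1) by simp
        then show ?thesis using incomparable_not_prefix[OF incomparable_sym[OF uv(1)]] by blast
      next
        case (2 s')
        \<comment> \<open>Here \<open>v\<close> moves along with \<open>u\<close>, so only \<open>x\<close> has to be avoided; the auxiliary word is
          incomparable with \<open>x\<close> because its state differs.\<close>
        have "incomparable (fst x + 1, []) x"
          by (auto simp: incomparable_def append_word_def)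
        then obtain y where y: "y \<in> level 2" "incomparable x y"
          using incomparable_word_of_length_two[OF x(2)] by blast
        have words: "x \<in> finite_words" "y \<in> finite_words" using x y level_words by blast+
        then show ?thesis
          using conj[OF y, of "y \<cdot> s'"] replaces_append[OF replaces_swap(1)[OF y(2) words]] 2 uv(3) x(2) y(1)
          by (simp add: level_def)
      qed
    qed
  qed
  consider "3 < length (snd u)" | "3 < length (snd v)" | "length (snd u) \<le> 3" "length (snd v) \<le> 3"
    by linarith
  then show ?case
  proof cases
    case 1
    then show ?thesis using reduce less by blast
  next
    case 2
    have "swap v u \<in> generate G short_swaps"
    proof (rule reduce[OF incomparable_sym[OF less.prems(1)] less.prems(3,2) 2])
      fix u' v' :: "nat \<times> nat list"
      assume "length (snd u') + length (snd v') < length (snd v) + length (snd u)"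
        "incomparable u' v'" "u' \<in> finite_words" "v' \<in> finite_words"
      then show "swap u' v' \<in> generate G short_swaps" using less.hyps[of u' v'] by simp
    qed
    then show ?thesis using swap_commute[OF less.prems(1)] by simp
  next
    case 3
    then have "swap u v \<in> short_swaps" unfolding short_swaps_def using less.prems by blast
    then show ?thesis by (rule generate.incl)
  qed
qed

definition replacement_map ::
    "(nat \<times> nat stream \<Rightarrow> nat \<times> nat stream) \<Rightarrow> nat \<Rightarrow> (nat \<times> nat list \<Rightarrow> nat \<times> nat list) \<Rightarrow> bool" where
  "replacement_map g k \<phi> \<longleftrightarrow>
     g \<in> carrier G \<and> (\<forall>b \<in> level k. \<phi> b \<in> finite_words \<and> replaces g b (\<phi> b))"

lemma replacement_map_incomparable:
  assumes "replacement_map g k \<phi>" "b \<in> level k" "c \<in> level k" "b \<noteq> c"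
  shows "incomparable (\<phi> b) (\<phi> c)"
proof (rule images_incomparable)
  show "incomparable b c" using assms(2-4) by (intro incomparable_same_length) (auto simp: level_def)
qed (use assms level_words in \<open>auto simp: replacement_map_def\<close>)

lemma replacement_map_prefix_eq:
  assumes "replacement_map g k \<phi>" "b \<in> level k" "c \<in> level k" "\<phi> b \<cdot> s = \<phi> c \<cdot> t"
  shows "b = c"
  using replacement_map_incomparable[OF assms(1-3)] assms(4) by (auto simp: incomparable_def)

lemma replacement_map_covers:
  assumes "replacement_map g k \<phi>" "\<omega> \<in> \<Omega>"
  obtains b t where "b \<in> level k" "t \<in> tails" "\<omega> = extend (\<phi> b) t"
proof -
  have "bij_betw g \<Omega> \<Omega>" using assms(1) by (simp add: replacement_map_def carrier_iff Bij_def)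
  then obtain \<omega>' where \<omega>': "\<omega>' \<in> \<Omega>" "\<omega> = g \<omega>'" using assms(2) by (metis bij_betw_imp_surj_on imageE)
  obtain b t where "b \<in> level k" "t \<in> tails" "\<omega>' = extend b t" using Omega_split[OF \<omega>'(1)] .
  then show thesis using that assms(1) \<omega>'(2) by (auto simp: replacement_map_def replaces_def)
qed

text \<open>
  If no replacing word is longer than \<open>k\<close>, then none is shorter: padding them to length \<open>k\<close> is an
  injection of the finite level into itself, hence onto, but a shorter word could be padded in a
  second way.
\<close>

lemma replacement_map_onto_level:
  assumes rep: "replacement_map g k \<phi>" and short: "\<And>b. b \<in> level k \<Longrightarrow> length (snd (\<phi> b)) \<le> k"
    and b: "b \<in> level k"
  shows "\<phi> b \<in> level k"
proof (rule ccontr)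
  assume not_level: "\<phi> b \<notin> level k"
  define pad where "pad a c = \<phi> c \<cdot> replicate (k - length (snd (\<phi> c))) a" for a :: nat and c
  have pad: "pad a c \<in> level k" if "a < n" "c \<in> level k" for a c
  proof -
    have "\<phi> c \<in> finite_words" using rep that(2) by (simp add: replacement_map_def)
    then show ?thesis using that(1) short[OF that(2)] by (auto simp: pad_def level_def)
  qed
  have "inj_on (pad 0) (level k)"
    by (rule inj_onI) (use replacement_map_prefix_eq[OF rep] in \<open>simp add: pad_def\<close>)
  then have "pad 0 ` level k = level k"
    using pad[of 0] n by (intro endo_inj_surj[OF finite_level]) (simp_all add: image_subset_iff)
  moreover have "pad 1 b \<in> level k" using pad b n by simp
  ultimately obtain c where c: "c \<in> level k" "pad 1 b = pad 0 c" by blast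
  then have "b = c" using replacement_map_prefix_eq[OF rep b] by (simp add: pad_def)
  with c(2) have "k - length (snd (\<phi> b)) = 0"
    by (cases "k - length (snd (\<phi> b))") (simp_all add: pad_def append_word_def)
  moreover have "\<phi> b \<in> finite_words" using rep b by (simp add: replacement_map_def)
  ultimately show False using not_level short[OF b] by (simp add: level_def)
qed

text \<open>
  The replacing words form a barrier, so the siblings of a longest one are replacing words too.
\<close>

lemma replacement_map_siblings:
  assumes rep: "replacement_map g k \<phi>" and b: "b \<in> level k" "\<phi> b = d \<cdot> [x]"
    and longest: "\<And>c. c \<in> level k \<Longrightarrow> length (snd (\<phi> c)) \<le> length (snd (\<phi> b))" and a: "a < n"
  obtains c where "c \<in> level k" "\<phi> c = d \<cdot> [a]"
proof -
  obtain t where t: "t \<in> tails" by (rule tails_nonempty)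
  have "d \<in> finite_words" using rep b by (auto simp: replacement_map_def)
  then have "extend (d \<cdot> [a]) t \<in> \<Omega>" using t a by simp
  then obtain c s where c: "c \<in> level k" "extend (d \<cdot> [a]) t = extend (\<phi> c) s"
    using replacement_map_covers[OF rep] by metis
  moreover have "length (snd (\<phi> c)) \<le> length (snd (d \<cdot> [a]))"
    using longest[OF c(1)] b(2) by simp
  ultimately obtain u where u: "d \<cdot> [a] = \<phi> c \<cdot> u"
    using extend_eq_extend[of "\<phi> c" s "d \<cdot> [a]" t] by metis
  show thesis
  proof (cases u rule: rev_exhaust)
    case Nil
    then show thesis using that c(1) u by simp
  next
    case (snoc u' y)
    then have d: "d = \<phi> c \<cdot> u'" using u by (auto simp: append_word_def prod_eq_iff)
    then have "\<phi> b \<cdot> [] = \<phi> c \<cdot> (u' @ [x])" using b(2) by simp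
    then have "b = c" using replacement_map_prefix_eq[OF rep b(1) c(1)] by blast
    with b(2) d have "length (snd d) = length (snd d) + 1 + length u'"
      by (metis append_word_simps(2) length_append length_Cons list.size(3) add.assoc add_0 One_nat_def)
    then show thesis by simp
  qed
qed

text \<open>
  If no replacing word were shorter than \<open>k\<close>, truncation to length \<open>k\<close> would map the level onto itself,
  hence be injective, which two long replacing words with a common prefix of length \<open>k\<close> contradict.
\<close>

lemma replacement_map_has_short_image:
  assumes rep: "replacement_map g k \<phi>" and bc: "b \<in> level k" "c \<in> level k" "b \<noteq> c"
    and d: "\<phi> b = d \<cdot> s" "\<phi> c = d \<cdot> t" "k \<le> length (snd d)"
  obtains e where "e \<in> level k" "length (snd (\<phi> e)) < k"
proof (rule ccontr)
  assume "\<not> thesis"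
  then have long: "k \<le> length (snd (\<phi> e))" if "e \<in> level k" for e
    using that \<open>\<And>e. e \<in> level k \<Longrightarrow> length (snd (\<phi> e)) < k \<Longrightarrow> thesis\<close> by (meson not_le)
  \<comment> \<open>Truncation to length \<open>k\<close>.\<close>
  define cut where "cut e = (fst (\<phi> e), take k (snd (\<phi> e)))" for e
  have "level k \<subseteq> cut ` level k"
  proof
    fix e assume e: "e \<in> level k"
    obtain t where "t \<in> tails" by (rule tails_nonempty)
    then have "extend e t \<in> \<Omega>" using level_words[OF e] by simp
    then obtain e' s where e': "e' \<in> level k" "extend e t = extend (\<phi> e') s"
      using replacement_map_covers[OF rep] by metis
    moreover have "length (snd e) \<le> length (snd (\<phi> e'))" using long[OF e'(1)] e by (simp add: level_def)
    ultimately obtain u where "\<phi> e' = e \<cdot> u" using extend_eq_extend by metis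
    then have "cut e' = e" using e by (simp add: cut_def level_def prod_eq_iff)
    then show "e \<in> cut ` level k" using e'(1) by blast
  qed
  then have "inj_on cut (level k)"
    using finite_level by (metis card_image_le card_mono eq_card_imp_inj_on finite_imageI le_antisym)
  moreover have "cut b = cut c" using d by (simp add: cut_def)
  ultimately show False using bc by (meson inj_onD)
qed

lemma replacement_map_swap:
  assumes rep: "replacement_map g k \<phi>" and uv: "incomparable u v" "u \<in> finite_words" "v \<in> finite_words"
    and \<psi>: "\<And>b. b \<in> level k \<Longrightarrow>
      (\<exists>s. \<phi> b = u \<cdot> s \<and> \<psi> b = v \<cdot> s) \<or> (\<exists>s. \<phi> b = v \<cdot> s \<and> \<psi> b = u \<cdot> s) \<or>
      incomparable (\<phi> b) u \<and> incomparable (\<phi> b) v \<and> \<psi> b = \<phi> b"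
  shows "replacement_map (swap u v \<otimes>\<^bsub>G\<^esub> g) k \<psi>"
  unfolding replacement_map_def
proof (intro conjI ballI)
  have g: "g \<in> carrier G" and \<phi>: "\<And>b. b \<in> level k \<Longrightarrow> \<phi> b \<in> finite_words \<and> replaces g b (\<phi> b)"
    using rep by (auto simp: replacement_map_def)
  note swap = swap_closed[OF uv]
  show "swap u v \<otimes>\<^bsub>G\<^esub> g \<in> carrier G" using swap g by simp
  fix b assume b: "b \<in> level k"
  have "\<psi> b \<in> finite_words \<and> replaces (swap u v) (\<phi> b) (\<psi> b)"
    using \<psi>[OF b]
  proof (elim disjE exE conjE)
    fix s assume s: "\<phi> b = u \<cdot> s" "\<psi> b = v \<cdot> s"
    with \<phi>[OF b] have "s \<in> lists {..<n}" by simp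
    then show ?thesis using s uv(3) replaces_append[OF replaces_swap(1)[OF uv]] by simp
  next
    fix s assume s: "\<phi> b = v \<cdot> s" "\<psi> b = u \<cdot> s"
    with \<phi>[OF b] have "s \<in> lists {..<n}" by simp
    then show ?thesis using s uv(2) replaces_append[OF replaces_swap(2)[OF uv]] by simp
  next
    assume "incomparable (\<phi> b) u" "incomparable (\<phi> b) v" "\<psi> b = \<phi> b"
    then show ?thesis using \<phi>[OF b] replaces_swap(3)[OF uv] by simp
  qed
  then show "\<psi> b \<in> finite_words" "replaces (swap u v \<otimes>\<^bsub>G\<^esub> g) b (\<psi> b)"
    using replaces_mult[OF g swap level_words[OF b]] \<phi>[OF b] by blast+
qed

lemma generated_if_swapped_generated:
  assumes "g \<in> carrier G" "incomparable u v" "u \<in> finite_words" "v \<in> finite_words"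
    and "swap u v \<otimes>\<^bsub>G\<^esub> g \<in> generate G short_swaps"
  shows "g \<in> generate G short_swaps"
proof -
  note swap = swap_closed[OF assms(2-4)]
  have "inv\<^bsub>G\<^esub> (swap u v) \<otimes>\<^bsub>G\<^esub> (swap u v \<otimes>\<^bsub>G\<^esub> g) = g"
    using swap assms(1) by (simp add: m_assoc[symmetric])
  moreover have "inv\<^bsub>G\<^esub> (swap u v) \<in> generate G short_swaps"
    using generate_m_inv_closed[OF short_swaps_closed] swap_in_generated assms(2-4) by blast
  ultimately show ?thesis using assms(5) by (metis generate.eng)
qed

text \<open>
  As every permutation of a finite set is a product of transpositions: each swap used here fixes one
  more word of the level.
\<close>

lemma level_permutation_in_generated:
  assumes "replacement_map g k \<phi>" "\<And>b. b \<in> level k \<Longrightarrow> \<phi> b \<in> level k"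
  shows "g \<in> generate G short_swaps"
  using assms
proof (induction "card {b \<in> level k. \<phi> b \<noteq> b}" arbitrary: g \<phi> rule: less_induct)
  case less
  note rep = less.prems(1)
  have g: "g \<in> carrier G" using rep by (simp add: replacement_map_def)
  show ?case
  proof (cases "\<exists>b \<in> level k. \<phi> b \<noteq> b")
    case False
    have "g = \<one>\<^bsub>G\<^esub>"
    proof (rule carrier_eqI[OF g one_closed])
      fix \<omega> assume \<omega>: "\<omega> \<in> \<Omega>"
      obtain b t where "b \<in> level k" "t \<in> tails" "\<omega> = extend b t" using Omega_split[OF \<omega>] .
      then show "g \<omega> = \<one>\<^bsub>G\<^esub> \<omega>"
        using False rep \<omega> by (auto simp: replacement_map_def replaces_def one_apply)
    qed
    then show ?thesis using generate.one by simp
  next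
    case True
    then obtain b where b: "b \<in> level k" "\<phi> b \<noteq> b" by blast
    define c where "c = \<phi> b"
    have c: "c \<in> level k" "c \<noteq> b" using less.prems(2) b by (auto simp: c_def)
    have words: "b \<in> finite_words" "c \<in> finite_words" using b c level_words by auto
    have same_level: "incomparable x y" if "x \<in> level k" "y \<in> level k" "x \<noteq> y" for x y
      using that by (intro incomparable_same_length) (auto simp: level_def)
    define \<psi> where "\<psi> x = (if \<phi> x = b then c else if \<phi> x = c then b else \<phi> x)" for x
    have "replacement_map (swap b c \<otimes>\<^bsub>G\<^esub> g) k \<psi>"
    proof (rule replacement_map_swap[OF rep same_level[OF b(1) c(1)] words])
      fix x assume x: "x \<in> level k"
      show "(\<exists>s. \<phi> x = b \<cdot> s \<and> \<psi> x = c \<cdot> s) \<or> (\<exists>s. \<phi> x = c \<cdot> s \<and> \<psi> x = b \<cdot> s) \<or>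
        incomparable (\<phi> x) b \<and> incomparable (\<phi> x) c \<and> \<psi> x = \<phi> x"
        unfolding \<psi>_def using same_level less.prems(2)[OF x] b(1) c
        by (metis append_word_simps(3))
    qed (use c in simp)
    moreover have "\<psi> x \<in> level k" if "x \<in> level k" for x
      using less.prems(2)[OF that] b c by (simp add: \<psi>_def)
    moreover have "card {x \<in> level k. \<psi> x \<noteq> x} < card {x \<in> level k. \<phi> x \<noteq> x}"
    proof (rule psubset_card_mono)
      have inj: "x = b" if "x \<in> level k" "\<phi> x = c" for x
        using replacement_map_prefix_eq[OF rep that(1) b(1)] that(2) c_def by metis
      have "\<psi> b = b" using c by (simp add: \<psi>_def c_def)
      moreover have "\<psi> x = x" if "x \<in> level k" "\<phi> x = x" for x
        using that inj[OF that(1)] b(2) c by (auto simp: \<psi>_def)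
      ultimately show "{x \<in> level k. \<psi> x \<noteq> x} \<subset> {x \<in> level k. \<phi> x \<noteq> x}" using b by blast
    qed (simp add: finite_level)
    ultimately have "swap b c \<otimes>\<^bsub>G\<^esub> g \<in> generate G short_swaps" using less.hyps by blast
    then show ?thesis
      using generated_if_swapped_generated[OF g same_level[OF b(1) c(1)] words] c(2) by simp
  qed
qed

text \<open>
  The induction is on the total excess of the replacing words over the length \<open>k\<close>. While some are longer,
  the longest come as a full set of siblings \<open>d \<cdot> [a]\<close>, and some replacing word \<open>y\<close> is shorter than
  \<open>k\<close>. The swap of \<open>d\<close> and \<open>y\<close> moves the siblings below \<open>y\<close>, where they have no excess, in exchange
  for the single word \<open>d\<close>, which has one letter less. In the end the element permutes a level.
\<close>

lemma replacement_map_in_generated: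
  assumes "replacement_map g k \<phi>"
  shows "g \<in> generate G short_swaps"
  using assms
proof (induction "\<Sum>b \<in> level k. length (snd (\<phi> b)) - k" arbitrary: g \<phi> rule: less_induct)
  case less
  note rep = less.prems
  have g: "g \<in> carrier G" and \<phi>: "\<And>b. b \<in> level k \<Longrightarrow> \<phi> b \<in> finite_words"
    using rep by (auto simp: replacement_map_def)
  show ?case
  proof (cases "\<forall>b \<in> level k. length (snd (\<phi> b)) \<le> k")
    case True
    then show ?thesis
      using level_permutation_in_generated[OF rep] replacement_map_onto_level[OF rep] by blast
  next
    case False
    then obtain b' where b': "b' \<in> level k" "k < length (snd (\<phi> b'))" by auto
    define m where "m = Max ((\<lambda>b. length (snd (\<phi> b))) ` level k)"
    have longest: "length (snd (\<phi> b)) \<le> m" if "b \<in> level k" for b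
      using that finite_level by (auto simp: m_def intro: Max_ge)
    have "m \<in> (\<lambda>b. length (snd (\<phi> b))) ` level k"
      unfolding m_def using b'(1) finite_level by (intro Max_in) auto
    then obtain b where b: "b \<in> level k" "length (snd (\<phi> b)) = m" by auto
    have "k < m" using b' longest by fastforce
    then obtain d x where d: "\<phi> b = d \<cdot> [x]"
      using b(2) by (cases "\<phi> b" rule: append_word_last_cases) auto
    have len_d: "m = Suc (length (snd d))" using b(2) d by simp
    have d_words: "d \<in> finite_words" using \<phi>[OF b(1)] d by simp
    have sibling: "\<exists>c \<in> level k. \<phi> c = d \<cdot> [a]" if "a < n" for a
      using replacement_map_siblings[OF rep b(1) d _ that] longest b(2) by metis
    obtain b\<^sub>0 where b\<^sub>0: "b\<^sub>0 \<in> level k" "\<phi> b\<^sub>0 = d \<cdot> [0]" using sibling[of 0] n by auto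
    obtain b\<^sub>1 where b\<^sub>1: "b\<^sub>1 \<in> level k" "\<phi> b\<^sub>1 = d \<cdot> [1]" using sibling[of 1] n by auto
    have "b\<^sub>0 \<noteq> b\<^sub>1" using b\<^sub>0 b\<^sub>1 by (auto simp: append_word_def)
    then obtain e where e: "e \<in> level k" "length (snd (\<phi> e)) < k"
      using replacement_map_has_short_image[OF rep b\<^sub>0(1) b\<^sub>1(1) _ b\<^sub>0(2) b\<^sub>1(2)] len_d \<open>k < m\<close>
      by (metis less_Suc_eq_le)
    define y where "y = \<phi> e"
    have y_words: "y \<in> finite_words" using \<phi>[OF e(1)] by (simp add: y_def)
    have outside_d: "incomparable (\<phi> c) d"
      if c: "c \<in> level k" and not_child: "\<And>a. \<phi> c \<noteq> d \<cdot> [a]" for c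
    proof (rule ccontr)
      assume "\<not> incomparable (\<phi> c) d"
      then show False
      proof (cases rule: comparable_cases)
        case (1 u)
        then have "\<phi> c \<cdot> (u @ [0]) = \<phi> b\<^sub>0 \<cdot> []" using b\<^sub>0(2) by simp
        then show False using replacement_map_prefix_eq[OF rep c b\<^sub>0(1)] not_child b\<^sub>0(2) by blast
      next
        case (2 u)
        have "length u \<le> 1" using longest[OF c] 2 len_d by simp
        then consider "u = []" | a where "u = [a]" by (cases u) auto
        then show False
        proof cases
          case 1
          then have "\<phi> c \<cdot> [0] = \<phi> b\<^sub>0 \<cdot> []" using 2 b\<^sub>0(2) by simp
          then show False using replacement_map_prefix_eq[OF rep c b\<^sub>0(1)] not_child b\<^sub>0(2) by blast
        next
          case 2
          then show False using not_child \<open>\<phi> c = d \<cdot> u\<close> by blast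
        qed
      qed
    qed
    have dy: "incomparable d y"
      unfolding y_def
    proof (rule incomparable_sym, rule outside_d[OF e(1)])
      show "\<phi> e \<noteq> d \<cdot> [a]" for a using e(2) len_d \<open>k < m\<close> by auto
    qed
    define \<psi> where "\<psi> c = (if c = e then d else if \<exists>a. \<phi> c = d \<cdot> [a] then y \<cdot> [last (snd (\<phi> c))] else \<phi> c)" for c
    have "replacement_map (swap d y \<otimes>\<^bsub>G\<^esub> g) k \<psi>"
    proof (rule replacement_map_swap[OF rep dy d_words y_words])
      fix c assume c: "c \<in> level k"
      consider "c = e" | a where "c \<noteq> e" "\<phi> c = d \<cdot> [a]" | "c \<noteq> e" "\<And>a. \<phi> c \<noteq> d \<cdot> [a]" by blast
      then show "(\<exists>s. \<phi> c = d \<cdot> s \<and> \<psi> c = y \<cdot> s) \<or> (\<exists>s. \<phi> c = y \<cdot> s \<and> \<psi> c = d \<cdot> s) \<or>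
        incomparable (\<phi> c) d \<and> incomparable (\<phi> c) y \<and> \<psi> c = \<phi> c"
      proof cases
        case 1
        then have "\<phi> c = y \<cdot> [] \<and> \<psi> c = d \<cdot> []" by (simp add: \<psi>_def y_def)
        then show ?thesis by blast
      next
        case (2 a)
        then have "\<phi> c = d \<cdot> [a] \<and> \<psi> c = y \<cdot> [a]" by (auto simp: \<psi>_def)
        then show ?thesis by blast
      next
        case 3
        then show ?thesis
          using outside_d[OF c] replacement_map_incomparable[OF rep c e(1)] by (auto simp: \<psi>_def y_def)
      qed
    qed
    moreover have "(\<Sum>c \<in> level k. length (snd (\<psi> c)) - k) < (\<Sum>c \<in> level k. length (snd (\<phi> c)) - k)"
    proof -
      have "e \<noteq> b\<^sub>0" using e(2) b\<^sub>0(2) len_d \<open>k < m\<close> by auto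
      have split: "(\<Sum>c \<in> level k. f c) = f e + f b\<^sub>0 + (\<Sum>c \<in> level k - {e, b\<^sub>0}. f c)" for f :: "_ \<Rightarrow> nat"
        using sum.subset_diff[of "{e, b\<^sub>0}" "level k" f] e(1) b\<^sub>0(1) finite_level \<open>e \<noteq> b\<^sub>0\<close> by simp
      have "length (snd y) < k" using e(2) by (simp add: y_def)
      have "(\<Sum>c \<in> level k - {e, b\<^sub>0}. length (snd (\<psi> c)) - k) \<le> (\<Sum>c \<in> level k - {e, b\<^sub>0}. length (snd (\<phi> c)) - k)"
        by (rule sum_mono) (use \<open>length (snd y) < k\<close> in \<open>auto simp: \<psi>_def\<close>)
      moreover have "length (snd (\<psi> e)) - k + (length (snd (\<psi> b\<^sub>0)) - k) < length (snd (\<phi> e)) - k + (length (snd (\<phi> b\<^sub>0)) - k)"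
        using \<open>e \<noteq> b\<^sub>0\<close> b\<^sub>0(2) len_d \<open>k < m\<close> \<open>length (snd y) < k\<close> by (auto simp: \<psi>_def)
      ultimately show ?thesis unfolding split by linarith
    qed
    ultimately have "swap d y \<otimes>\<^bsub>G\<^esub> g \<in> generate G short_swaps" using less.hyps by blast
    then show ?thesis using generated_if_swapped_generated[OF g dy d_words y_words] by blast
  qed
qed

theorem finitely_generated: "finite_generating_set G short_swaps"
proof -
  have "g \<in> generate G short_swaps" if g: "g \<in> carrier G" for g
  proof -
    obtain k where "replaces_at_level g k" using g carrier_iff by blast
    then obtain \<phi> where "\<And>b. b \<in> level k \<Longrightarrow> \<phi> b \<in> finite_words \<and> replaces g b (\<phi> b)"
      by (metis replaces_at_level_def)
    then have "replacement_map g k \<phi>" using g by (simp add: replacement_map_def)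
    then show ?thesis by (rule replacement_map_in_generated)
  qed
  then show ?thesis
    unfolding finite_generating_set_def
    using finite_short_swaps short_swaps_closed generate_incl[OF short_swaps_closed] by blast
qed

end

theorem theorem1:
  fixes n r :: nat
  assumes "n \<ge> 2" and "r \<ge> 1"
  shows "co_context_free (higman_thompson n r)"
proof -
  interpret higman_thompson_parameters n r using assms by unfold_locales
  show ?thesis
    unfolding co_context_free_def
    using is_group finitely_generated coword_problem_context_free
    by (auto simp: finite_generating_set_def)
qed

end
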